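(* Let $a>0$, $w>0$, $t>0$ and put $A=a^2w$. For $b>0$ let $\mathcal{P}^{w.e.}_b(\zeta,t)$ be the limiting joint density at the weakly non-normal edge with parameter $b$ (given in the context). With $b=b(\nu)=\frac{a}{\nu\sqrt2}$, $$\lim_{\nu\to\infty}\nu^{-1}\,\mathcal{P}^{w.e.}_{b(\nu)}(-\nu^2w,t)=\frac{A\sqrt{w}}{2\pi t^2}e^{-\frac{A}{2t}}\left[\left(\frac2A-\frac1t\right)e^{-\frac A2}+\left(1+\frac1t-\frac2A\right)\int_0^1e^{-\frac{As^2}{2}}ds\right].$$
   Context: Deformed Airy function: $\mathrm{Ai}_b(\zeta)=e^{\frac{b^2\zeta}{2}+\frac{b^6}{12}}\mathrm{Ai}\left(\zeta+\frac{b^4}{4}\right)$, where $\mathrm{Ai}$ is the Airy function. The function $\mathcal{P}^{w.e.}_b$, for $\zeta\in\mathbb{R}$ and $t>0$, is $$\mathcal{P}^{w.e.}_b(\zeta,t)=\frac{b^2}{t^2}\left[T_0(\zeta)+\frac{b^2T_1(\zeta)}{t}+\frac{b^4T_2(\zeta)}{t^2}+\frac{b^6T_3(\zeta)}{t^3}\right]\exp\left(\frac{b^2\zeta}{t}-\frac{b^6}{2t^2}-\frac{b^6}{3t^3}\right),$$ with (all depending on $b$) $$T_3(\zeta)=\int_\zeta^\infty\left[\mathrm{Ai}_b'(p)^2-\mathrm{Ai}_b(p)\mathrm{Ai}_b''(p)\right]dp,$$ $$T_2(\zeta)=b^2T_3(\zeta)+\int_\zeta^\infty\mathrm{Ai}_b(p)^2dp,$$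 $$T_1(\zeta)=-\zeta T_3(\zeta)+\tfrac12\mathrm{Ai}_b(\zeta)^2+b^2\int_\zeta^\infty\mathrm{Ai}_b(p)^2dp,$$ $$T_0(\zeta)=-T_3(\zeta)+\tfrac12b^2\mathrm{Ai}_b(\zeta)^2-\tfrac12\mathrm{Ai}_b(\zeta)\mathrm{Ai}_b'(\zeta)-\zeta\int_\zeta^\infty\mathrm{Ai}_b(p)^2dp.$$ (It arises as the scaling limit, at the spectral edge and with $(1-\tau)N^{1/3}=b^2$, of the joint density of a real eigenvalue and its squared condition number minus one in the real elliptic Gaussian ensemble; the explicit formula above is taken as its definition here.) *)

theory Defs
  imports "HOL-Analysis.Analysis"
begin

text \<open>
  The defining integral of the Airy function on the real line converges only conditionally.
  The Henstock--Kurzweil \<open>integral\<close> over an unbounded interval is the limit of the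
  integrals over bounded intervals, so it is the improper integral
  \<open>lim\<^sub>R \<integral>\<^sub>0\<^sup>R\<close> meant here; the Lebesgue integral would not do.
\<close>

definition Airy_Ai :: "real \<Rightarrow> real" where
  "Airy_Ai x = 1 / pi * integral {0..} (\<lambda>s. cos (s ^ 3 / 3 + x * s))"

definition deformed_Ai :: "real \<Rightarrow> real \<Rightarrow> real" where
  "deformed_Ai b \<zeta> = exp (b\<^sup>2 * \<zeta> / 2 + b ^ 6 / 12) * Airy_Ai (\<zeta> + b ^ 4 / 4)"

definition T3 :: "real \<Rightarrow> real \<Rightarrow> real" where
  "T3 b \<zeta> = integral {\<zeta>..}
     (\<lambda>p. (deriv (deformed_Ai b) p)\<^sup>2 - deformed_Ai b p * deriv (deriv (deformed_Ai b)) p)"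

definition T2 :: "real \<Rightarrow> real \<Rightarrow> real" where
  "T2 b \<zeta> = b\<^sup>2 * T3 b \<zeta> + integral {\<zeta>..} (\<lambda>p. (deformed_Ai b p)\<^sup>2)"

definition T1 :: "real \<Rightarrow> real \<Rightarrow> real" where
  "T1 b \<zeta> = - \<zeta> * T3 b \<zeta> + 1 / 2 * (deformed_Ai b \<zeta>)\<^sup>2
     + b\<^sup>2 * integral {\<zeta>..} (\<lambda>p. (deformed_Ai b p)\<^sup>2)"

definition T0 :: "real \<Rightarrow> real \<Rightarrow> real" where
  "T0 b \<zeta> = - T3 b \<zeta> + 1 / 2 * b\<^sup>2 * (deformed_Ai b \<zeta>)\<^sup>2
     - 1 / 2 * deformed_Ai b \<zeta> * deriv (deformed_Ai b) \<zeta>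
     - \<zeta> * integral {\<zeta>..} (\<lambda>p. (deformed_Ai b p)\<^sup>2)"

definition P_we :: "real \<Rightarrow> real \<Rightarrow> real \<Rightarrow> real" where
  "P_we b \<zeta> t = b\<^sup>2 / t\<^sup>2 *
     (T0 b \<zeta> + b\<^sup>2 * T1 b \<zeta> / t + b ^ 4 * T2 b \<zeta> / t\<^sup>2 + b ^ 6 * T3 b \<zeta> / t ^ 3) *
     exp (b\<^sup>2 * \<zeta> / t - b ^ 6 / (2 * t\<^sup>2) - b ^ 6 / (3 * t ^ 3))"

end

theory Submission
  imports Defs "HOL-Complex_Analysis.Complex_Analysis" "HOL-Probability.Probability"
begin

text \<open>
  The Airy function solves \<open>Ai'' = x Ai\<close>, so the energy \<open>E = Ai'\<^sup>2 - x Ai\<^sup>2\<close> satisfies \<open>E' = - Ai\<^sup>2\<close>.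
  The integrand of \<open>T3\<close> is an exponential times \<open>E\<close>, and integration by parts expresses
  \<open>\<integral> Ai\<^sub>b\<^sup>2\<close> by \<open>E\<close> as well. Hence the limit only needs \<open>E(-y) \<sim> \<surd>y / \<pi>\<close> as \<open>y \<rightarrow> \<infinity>\<close>, in which the
  oscillations of \<open>Ai\<close> have cancelled, and a dominated convergence argument. The asymptotics of
  \<open>E\<close> come from moving the contour of the Airy integral to the ray from \<open>\<i>\<eta>\<close> in direction \<open>1 + \<i>\<close>:
  \<open>\<eta> = 1\<close> gives exponential decay on the right, and \<open>\<eta> = - \<surd>y\<close> gives a ray through the saddle point.
\<close>

section \<open>Moments of the Airy kernel along a ray\<close>

text \<open>Three obstacles shape the proof. The Airy integral converges only conditionally, so it
  cannot be differentiated under the integral sign on the real line; on the tilted ray all moments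
  converge absolutely, and a primitive of the entire kernel compares the two contours by its values
  alone. Next, Ai(-y) and Ai'(-y) oscillate, but after rescaling they are asymptotic to the real
  parts of \<open>u\<close> and \<open>\<i> * u\<close> times one Gaussian constant, for a complex
  \<open>u\<close> of fixed modulus, so the energy sees only \<open>norm u\<close>. Finally, the
  pieces of the density have different sizes. With b^2 = a^2 / (2 \<nu>^2) and \<zeta> = - \<nu>^2 w
  the product b^2 \<zeta> is the constant - A / 2. Then \<open>T3\<close> has order \<nu>^3 and the
  integral of Ai_b^2 has order \<nu>, so three terms of order \<nu>^3 survive: - \<open>T3\<close>,
  - \<zeta> times that integral, and the contribution of - \<zeta> \<open>T3\<close> to b^2
  \<open>T1\<close> / t. The prefactor b^2 lowers the order to \<nu>. The boundary values of Ai_b^2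
  and Ai_b Ai_b' need only be o(\<nu>^3), which a bound by the energy provides.\<close>

lemma has_integral_improper:
  fixes f :: "real \<Rightarrow> real"
  assumes int: "\<And>R. f integrable_on {a..R}"
    and lim: "((\<lambda>R. integral {a..R} f) \<longlongrightarrow> l) at_top"
  shows "(f has_integral l) {a..}"
proof -
  have nbox: "\<not> (\<exists>u v. {a..} = cbox u v)"
    by (metis bounded_cbox not_Ici_le_Icc box_real(2) order_refl)
  have "\<exists>B>0. \<forall>u v. ball 0 B \<subseteq> cbox u v \<longrightarrow>
      (\<exists>z. ((\<lambda>x. if x \<in> {a..} then f x else 0) has_integral z) (cbox u v) \<and> norm (z - l) < e)"
    if "e > 0" for e
  proof -
    obtain N where N: "\<And>R. R \<ge> N \<Longrightarrow> \<bar>integral {a..R} f - l\<bar> < e"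
      using tendstoD[OF lim \<open>e > 0\<close>] by (auto simp: eventually_at_top_linorder dist_real_def)
    \<comment> \<open>Every box that contains the ball of radius \<open>B\<close> starts left of
      \<open>a\<close> and ends right of \<open>N\<close>, so its part in \<open>{a..}\<close> is an
      interval for which the limit is already close.\<close>
    define B where "B = \<bar>N\<bar> + \<bar>a\<bar> + 1"
    show ?thesis
    proof (rule exI[of _ B], intro conjI allI impI)
      show B_pos: "B > 0" by (simp add: B_def)
      fix u v :: real assume sub: "ball 0 B \<subseteq> cbox u v"
      have "{-B<..<B} \<subseteq> {u..v}" using sub by (simp add: ball_eq_greaterThanLessThan)
      then have uv: "u \<le> - B" "B \<le> v"
        using B_pos by (simp_all add: greaterThanLessThan_subseteq_atLeastAtMost_iff)
      have eq: "{a..} \<inter> cbox u v = {a..v}" using uv by (auto simp: B_def)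
      have "((\<lambda>x. if x \<in> {a..} then f x else 0) has_integral integral {a..v} f) (cbox u v)"
        unfolding has_integral_restrict_Int eq using int by (simp add: integrable_integral)
      moreover have "norm (integral {a..v} f - l) < e"
        using N[of v] uv by (simp add: B_def)
      ultimately show "\<exists>z. ((\<lambda>x. if x \<in> {a..} then f x else 0) has_integral z) (cbox u v)
          \<and> norm (z - l) < e" by blast
    qed
  qed
  then show ?thesis
    using nbox by (subst has_integral_alt) auto
qed

section \<open>The kernel on the ray and its integrable majorants\<close>

definition airy_kernel :: "real \<Rightarrow> complex \<Rightarrow> complex" where
  "airy_kernel x s = exp (\<i> * (s ^ 3 / 3 + of_real x * s))"

text \<open>Since \<open>(1 + \<i>) ^ 3 = - 2 + 2 * \<i>\<close>, the direction 1 + i turns the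
  cubic phase into the damping \<open>- 2 * r ^ 3 / 3\<close>, and since
  \<open>(1 + \<i>)\<^sup>2\<close> is imaginary the modulus has no quadratic term in
  \<open>r\<close>. It is also the steepest descent direction at a saddle on the positive real
  axis.\<close>

definition airy_ray :: "real \<Rightarrow> real \<Rightarrow> complex" where
  "airy_ray \<eta> r = \<i> * of_real \<eta> + (1 + \<i>) * of_real r"

text \<open>The \<open>k\<close>-th power is what \<open>k\<close> derivatives in \<open>x\<close>
  bring down from the kernel, up to \<open>\<i> ^ k\<close>. The Jacobian \<open>1 + \<i>\<close> of
  the ray is left out here and reappears in \<open>Airy_Ai_eq_moment\<close>.\<close>

definition airy_moment :: "nat \<Rightarrow> real \<Rightarrow> real \<Rightarrow> complex" where
  "airy_moment k \<eta> x =
     (LINT r:{0..}|lborel. airy_ray \<eta> r ^ k * airy_kernel x (airy_ray \<eta> r))"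

lemma airy_phase_ray:
  "\<i> * (airy_ray \<eta> r ^ 3 / 3 + of_real x * airy_ray \<eta> r) =
    Complex (\<eta> ^ 3 / 3 - x * \<eta> + (\<eta>\<^sup>2 - x) * r - 2 * r ^ 3 / 3)
            ((x - \<eta>\<^sup>2) * r - 2 * \<eta> * r\<^sup>2 - 2 * r ^ 3 / 3)"
  by (rule complex_eqI)
     (simp_all add: airy_ray_def power3_eq_cube power2_eq_square field_simps)

lemma norm_airy_kernel_ray:
  "norm (airy_kernel x (airy_ray \<eta> r)) =
    exp (\<eta> ^ 3 / 3 - x * \<eta> + (\<eta>\<^sup>2 - x) * r - 2 * r ^ 3 / 3)"
  unfolding airy_kernel_def airy_phase_ray by simp

lemma norm_airy_ray:
  assumes "r \<ge> 0"
  shows "norm (airy_ray \<eta> r) \<le> \<bar>\<eta>\<bar> + 2 * r"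
proof -
  have "norm (airy_ray \<eta> r) \<le> \<bar>\<eta>\<bar> + norm (1 + \<i>) * r"
    unfolding airy_ray_def using assms by (intro order_trans[OF norm_triangle_ineq]) (simp add: norm_mult)
  also have "norm (1 + \<i>) \<le> 2"
    using norm_triangle_ineq[of 1 \<i>] by simp
  finally show ?thesis using assms by (simp add: mult_right_mono)
qed

lemma exp_cubic_dominated:
  fixes B :: real
  obtains K where "K > 0" "\<And>r. r \<ge> 0 \<Longrightarrow> exp (B * r - 2 * r ^ 3 / 3) \<le> K * exp (- r)"
proof -
  \<comment> \<open>The 1 in \<open>m\<close> pays for the factor \<open>exp (- r)\<close>. Up to
    \<open>m + 2\<close> the linear term is bounded; beyond it \<open>2 * r ^ 3 / 3\<close> exceeds
    \<open>m * r\<close>, because \<open>3 * m / 2\<close> is at most the square of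
    \<open>m + 2\<close>.\<close>
  define m where "m = \<bar>B\<bar> + 1"
  have m: "m \<ge> 1" by (simp add: m_def)
  have "exp (B * r - 2 * r ^ 3 / 3) \<le> exp (m * (m + 2)) * exp (- r)" if r: "r \<ge> 0" for r
  proof -
    have "m * r - 2 * r ^ 3 / 3 \<le> m * (m + 2)"
    proof (cases "r \<le> m + 2")
      case True
      then have "m * r \<le> m * (m + 2)" using m by simp
      moreover have "0 \<le> r ^ 3" using r by simp
      ultimately show ?thesis by linarith
    next
      case False
      then have "(m + 2) * (m + 2) \<le> r * r" using m by (intro mult_mono) auto
      moreover have "3 * m / 2 \<le> (m + 2) * (m + 2)" using m by (simp add: algebra_simps add_increasing)
      ultimately have "3 * m / 2 \<le> r * r" by linarith
      then have "3 * m / 2 * r \<le> r * r * r" using r by (rule mult_right_mono)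
      then have "m * r - 2 * r ^ 3 / 3 \<le> 0" by (simp add: power3_eq_cube)
      also have "0 \<le> m * (m + 2)" using m by simp
      finally show ?thesis .
    qed
    moreover have "B * r + r \<le> m * r"
      using mult_right_mono[OF abs_ge_self[of B] r] by (simp add: m_def algebra_simps)
    ultimately show ?thesis
      by (simp flip: exp_add)
  qed
  then show ?thesis using that[of "exp (m * (m + 2))"] by simp
qed

text \<open>The factor \<open>exp (norm (airy_ray \<eta> r))\<close> leaves room for the Taylor
  remainder of the kernel under a shift of \<open>x\<close> by at most 1. It costs nothing: powers
  and exponentials of the distance only change the linear coefficient in the exponent, and the cubic
  term wins against any such coefficient.\<close>

lemma airy_ray_dominated:
  obtains K where "K > 0"
    "\<And>r. r \<ge> 0 \<Longrightarrow> norm (airy_ray \<eta> r) ^ k * exp (norm (airy_ray \<eta> r)) *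
        norm (airy_kernel x (airy_ray \<eta> r)) \<le> K * exp (- r)"
proof -
  \<comment> \<open>From \<open>?u \<le> exp ?u\<close> the power and the exponential together are
    at most \<open>exp (n * ?u)\<close>, which raises the slope in \<open>r\<close> by
    \<open>2 * n\<close>.\<close>
  define n where "n = real (Suc k)"
  obtain K where K: "K > 0" "\<And>r. r \<ge> 0 \<Longrightarrow> exp ((2 * n + \<eta>\<^sup>2 - x) * r - 2 * r ^ 3 / 3) \<le> K * exp (- r)"
    using exp_cubic_dominated by blast
  define C where "C = exp (n * \<bar>\<eta>\<bar> + \<eta> ^ 3 / 3 - x * \<eta>)"
  have "norm (airy_ray \<eta> r) ^ k * exp (norm (airy_ray \<eta> r)) *
        norm (airy_kernel x (airy_ray \<eta> r)) \<le> C * K * exp (- r)" if r: "r \<ge> 0" for r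
  proof -
    let ?u = "norm (airy_ray \<eta> r)"
    have "?u \<le> exp ?u" using exp_ge_add_one_self[of ?u] by linarith
    then have "?u ^ k * exp ?u \<le> exp ?u ^ k * exp ?u"
      by (intro mult_right_mono power_mono) auto
    also have "\<dots> = exp (n * ?u)" by (simp add: n_def exp_add algebra_simps flip: exp_of_nat_mult)
    also have "\<dots> \<le> exp (n * (\<bar>\<eta>\<bar> + 2 * r))"
      using norm_airy_ray[OF r] by (simp add: n_def)
    finally have "?u ^ k * exp ?u * norm (airy_kernel x (airy_ray \<eta> r))
        \<le> exp (n * (\<bar>\<eta>\<bar> + 2 * r)) * norm (airy_kernel x (airy_ray \<eta> r))"
      by (rule mult_right_mono) simp
    also have "\<dots> = C * exp ((2 * n + \<eta>\<^sup>2 - x) * r - 2 * r ^ 3 / 3)"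
      unfolding norm_airy_kernel_ray C_def by (simp add: algebra_simps flip: exp_add)
    also have "\<dots> \<le> C * (K * exp (- r))"
      using K(2)[OF r] by (simp add: C_def)
    finally show ?thesis by simp
  qed
  with that[of "C * K"] K show ?thesis by (simp add: C_def)
qed

lemma set_integrable_exp_minus_atLeast_0:
  "set_integrable lborel {0..} (\<lambda>r::real. exp (- r))"
proof -
  have "(\<lambda>x::real. exp (- 1 * x)) absolutely_integrable_on {0..}"
    by (intro nonnegative_absolutely_integrable_1 integrable_on_exp_minus_to_infinity) auto
  then show ?thesis
    by (simp add: set_integrable_def integrable_completion)
qed

lemma continuous_on_airy [continuous_intros]:
  "continuous_on S (\<lambda>r. airy_ray \<eta> r)"
  "continuous_on T f \<Longrightarrow> continuous_on T (\<lambda>r. airy_kernel x (f r))"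
  unfolding airy_ray_def airy_kernel_def by (auto intro!: continuous_intros)

lemma borel_measurable_airy [measurable]:
  "(\<lambda>r. airy_ray \<eta> r) \<in> borel_measurable borel"
  "airy_kernel x \<in> borel_measurable borel"
  by (intro borel_measurable_continuous_onI continuous_intros)+

lemma set_integrable_airy_moment:
  "set_integrable lborel {0..} (\<lambda>r. airy_ray \<eta> r ^ k * airy_kernel x (airy_ray \<eta> r))"
proof -
  obtain K where K: "K > 0" "\<And>r. r \<ge> 0 \<Longrightarrow> norm (airy_ray \<eta> r) ^ k * exp (norm (airy_ray \<eta> r)) *
        norm (airy_kernel x (airy_ray \<eta> r)) \<le> K * exp (- r)"
    using airy_ray_dominated by blast
  show ?thesis
  proof (rule set_integrable_bound)
    show "set_integrable lborel {0..} (\<lambda>r. K * exp (- r))"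
      using set_integrable_exp_minus_atLeast_0 by simp
    show "set_borel_measurable lborel {0..} (\<lambda>r. airy_ray \<eta> r ^ k * airy_kernel x (airy_ray \<eta> r))"
      unfolding set_borel_measurable_def by measurable
    have "norm (airy_ray \<eta> r ^ k * airy_kernel x (airy_ray \<eta> r)) \<le> norm (K * exp (- r))"
      if r: "r \<ge> 0" for r
    proof -
      have "norm (airy_ray \<eta> r) ^ k * 1 * norm (airy_kernel x (airy_ray \<eta> r))
          \<le> norm (airy_ray \<eta> r) ^ k * exp (norm (airy_ray \<eta> r)) * norm (airy_kernel x (airy_ray \<eta> r))"
        by (intro mult_right_mono mult_left_mono) auto
      with K(2)[OF r] K(1) show ?thesis by (simp add: norm_mult norm_power)
    qed
    then show "AE r in lborel. r \<in> {0..} \<longrightarrow>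
        norm (airy_ray \<eta> r ^ k * airy_kernel x (airy_ray \<eta> r)) \<le> norm (K * exp (- r))"
      by simp
  qed
qed

section \<open>Differentiation under the integral sign\<close>

text \<open>A quadratic remainder can be integrated as one inequality, so the moments are
  differentiated without passing to a limit inside the integral.\<close>

lemma has_vector_derivative_quadratic_error:
  fixes f :: "real \<Rightarrow> 'a::real_normed_vector"
  assumes "\<And>h. \<bar>h\<bar> \<le> 1 \<Longrightarrow> norm (f (x + h) - f x - h *\<^sub>R D) \<le> C * h\<^sup>2"
  shows "(f has_vector_derivative D) (at x)"
proof -
  have "((\<lambda>h. norm (f (x + h) - f x - h *\<^sub>R D) / norm h) \<longlongrightarrow> 0) (at 0)"
  proof (rule Lim_null_comparison)
    have "norm (norm (f (x + h) - f x - h *\<^sub>R D) / norm h) \<le> C * \<bar>h\<bar>" if "\<bar>h\<bar> < 1" for h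
      using assms[of h] that by (cases "h = 0") (simp_all add: divide_simps power2_eq_square mult.assoc)
    then show "\<forall>\<^sub>F h in at 0. norm (norm (f (x + h) - f x - h *\<^sub>R D) / norm h) \<le> C * \<bar>h\<bar>"
      by (auto simp: eventually_at dist_real_def intro!: exI[of _ 1])
    show "((\<lambda>h. C * \<bar>h\<bar>) \<longlongrightarrow> 0) (at 0)"
      by (rule tendsto_eq_intros | simp)+
  qed
  then show ?thesis
    unfolding has_vector_derivative_def has_derivative_at
    by (simp add: bounded_linear_scaleR_left)
qed

lemma airy_moment_has_vector_derivative:
  "(airy_moment k \<eta> has_vector_derivative \<i> * airy_moment (Suc k) \<eta> x) (at x)"
proof -
  \<comment> \<open>With z = i h s the remainder satisfies
    \<open>norm (exp z - (1 + z)) \<le> exp (norm z) * norm z ^ 2\<close>. The square supplies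
    \<open>h\<^sup>2\<close> and two more powers of the ray, hence \<open>k + 2\<close>; the
    exponential is independent of \<open>h\<close> after using |h| \<le> 1.\<close>
  obtain K where K: "K > 0" "\<And>r. r \<ge> 0 \<Longrightarrow> norm (airy_ray \<eta> r) ^ (k + 2) * exp (norm (airy_ray \<eta> r)) *
        norm (airy_kernel x (airy_ray \<eta> r)) \<le> K * exp (- r)"
    using airy_ray_dominated by blast
  let ?s = "airy_ray \<eta>"
  let ?C = "LINT r:{0..}|lborel. K * exp (- r)"
  show ?thesis
  proof (rule has_vector_derivative_quadratic_error[where C = ?C])
    fix h :: real assume h: "\<bar>h\<bar> \<le> 1"
    let ?d = "\<lambda>r. ?s r ^ k * airy_kernel (x + h) (?s r) - ?s r ^ k * airy_kernel x (?s r)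
        - (of_real h * \<i>) * (?s r ^ Suc k * airy_kernel x (?s r))"
    note int = set_integrable_airy_moment
    have "airy_moment k \<eta> (x + h) - airy_moment k \<eta> x - h *\<^sub>R (\<i> * airy_moment (Suc k) \<eta> x)
       = airy_moment k \<eta> (x + h) - airy_moment k \<eta> x - (of_real h * \<i>) * airy_moment (Suc k) \<eta> x"
      by (simp add: scaleR_conv_of_real)
    also have "\<dots> = (LINT r:{0..}|lborel. ?d r)"
      unfolding airy_moment_def set_integral_mult_right[symmetric]
      by (subst set_integral_diff(2)[symmetric] | intro set_integral_diff set_integrable_mult_right int refl)+
    finally have eq: "airy_moment k \<eta> (x + h) - airy_moment k \<eta> x - h *\<^sub>R (\<i> * airy_moment (Suc k) \<eta> x)
       = (LINT r:{0..}|lborel. ?d r)" .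
    have intd: "set_integrable lborel {0..} ?d"
      by (intro set_integral_diff set_integrable_mult_right int)
    have "norm (LINT r:{0..}|lborel. ?d r) \<le> (LINT r:{0..}|lborel. norm (?d r))"
      by (rule set_integral_norm_bound[OF intd])
    also have "\<dots> \<le> (LINT r:{0..}|lborel. h\<^sup>2 * (K * exp (- r)))"
    proof (rule set_integral_mono)
      show "set_integrable lborel {0..} (\<lambda>r. norm (?d r))" using intd by (rule set_integrable_norm)
      show "set_integrable lborel {0..} (\<lambda>r. h\<^sup>2 * (K * exp (- r)))"
        using set_integrable_exp_minus_atLeast_0 by simp
      fix r :: real assume "r \<in> {0..}"
      then have r: "r \<ge> 0" by simp
      let ?z = "\<i> * of_real h * ?s r"
      have nz: "norm ?z = \<bar>h\<bar> * norm (?s r)" by (simp add: norm_mult)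
      have "?d r = ?s r ^ k * airy_kernel x (?s r) * (exp ?z - (1 + ?z))"
        by (simp add: airy_kernel_def algebra_simps flip: exp_add)
      then have "norm (?d r) = norm (?s r) ^ k * norm (airy_kernel x (?s r)) * norm (exp ?z - (1 + ?z))"
        by (simp only: norm_mult norm_power)
      also have "\<dots> \<le> norm (?s r) ^ k * norm (airy_kernel x (?s r)) *
          (exp (norm (?s r)) * (\<bar>h\<bar> * norm (?s r)) ^ 2)"
      proof (rule mult_left_mono)
        have "norm (exp ?z - (1 + ?z)) \<le> exp (norm ?z) * norm ?z ^ 2"
          using Taylor_exp_field[of ?z 1] by (simp add: numeral_2_eq_2)
        also have "\<dots> \<le> exp (norm (?s r)) * (\<bar>h\<bar> * norm (?s r)) ^ 2"
          unfolding nz using h by (intro mult_right_mono) (auto intro: mult_left_le_one_le)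
        finally show "norm (exp ?z - (1 + ?z)) \<le> exp (norm (?s r)) * (\<bar>h\<bar> * norm (?s r)) ^ 2" .
      qed simp
      also have "\<dots> = h\<^sup>2 * (norm (?s r) ^ (k + 2) * exp (norm (?s r)) * norm (airy_kernel x (?s r)))"
        by (simp add: power_mult_distrib power_add power2_eq_square)
      also have "\<dots> \<le> h\<^sup>2 * (K * exp (- r))"
        using K(2)[OF r] by (intro mult_left_mono) auto
      finally show "norm (?d r) \<le> h\<^sup>2 * (K * exp (- r))" .
    qed
    also have "\<dots> = ?C * h\<^sup>2" by simp
    finally show "norm (airy_moment k \<eta> (x + h) - airy_moment k \<eta> x - h *\<^sub>R (\<i> * airy_moment (Suc k) \<eta> x)) \<le> ?C * h\<^sup>2"
      unfolding eq .
  qed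
qed

lemma set_integral_atLeast_tendsto:
  fixes f F :: "real \<Rightarrow> complex"
  assumes int: "set_integrable lborel {a..} f"
    and deriv: "\<And>r. r \<ge> a \<Longrightarrow> (F has_vector_derivative f r) (at r)"
  shows "(F \<longlongrightarrow> F a + (LINT r:{a..}|lborel. f r)) at_top"
proof -
  have "((\<lambda>y. \<integral>r. indicator {..y} r *\<^sub>R (indicator {a..} r *\<^sub>R f r) \<partial>lborel)
      \<longlongrightarrow> (LINT r:{a..}|lborel. f r)) at_top"
    unfolding set_lebesgue_integral_def
    using int by (intro tendsto_integral_at_top) (auto simp: set_integrable_def)
  moreover have "\<forall>\<^sub>F y in at_top. (\<integral>r. indicator {..y} r *\<^sub>R (indicator {a..} r *\<^sub>R f r) \<partial>lborel) = F y - F a"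
    using eventually_ge_at_top[of a]
  proof eventually_elim
    case (elim y)
    have "(\<integral>r. indicator {..y} r *\<^sub>R (indicator {a..} r *\<^sub>R f r) \<partial>lborel) = (LINT r:{a..y}|lborel. f r)"
      unfolding set_lebesgue_integral_def
      by (intro Bochner_Integration.integral_cong) (auto simp: indicator_def)
    also have "\<dots> = integral {a..y} f"
      by (intro set_borel_integral_eq_integral set_integrable_subset[OF int]) auto
    also have "\<dots> = F y - F a"
      using elim deriv
      by (intro integral_unique fundamental_theorem_of_calculus)
         (auto intro: has_vector_derivative_at_within)
    finally show ?case .
  qed
  ultimately have "((\<lambda>y. F y - F a) \<longlongrightarrow> (LINT r:{a..}|lborel. f r)) at_top"
    by (rule Lim_transform_eventually)
  from tendsto_add[OF tendsto_const this, of "F a"] show ?thesis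
    by simp
qed

lemma airy_kernel_ray_tendsto_0: "((\<lambda>r. airy_kernel x (airy_ray \<eta> r)) \<longlongrightarrow> 0) at_top"
proof -
  obtain K where K: "K > 0" "\<And>r. r \<ge> 0 \<Longrightarrow> exp ((\<eta>\<^sup>2 - x) * r - 2 * r ^ 3 / 3) \<le> K * exp (- r)"
    using exp_cubic_dominated by blast
  show ?thesis
  proof (rule Lim_null_comparison)
    show "\<forall>\<^sub>F r in at_top. norm (airy_kernel x (airy_ray \<eta> r)) \<le> exp (\<eta> ^ 3 / 3 - x * \<eta>) * (K * exp (- r))"
      using eventually_ge_at_top[of 0]
    proof eventually_elim
      case (elim r)
      have "norm (airy_kernel x (airy_ray \<eta> r)) = exp (\<eta> ^ 3 / 3 - x * \<eta>) * exp ((\<eta>\<^sup>2 - x) * r - 2 * r ^ 3 / 3)"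
        by (simp add: norm_airy_kernel_ray flip: exp_add)
      with K(2)[OF elim] show ?case by simp
    qed
    have "((\<lambda>r::real. exp (- r)) \<longlongrightarrow> 0) at_top" by real_asymp
    then show "((\<lambda>r. exp (\<eta> ^ 3 / 3 - x * \<eta>) * (K * exp (- r))) \<longlongrightarrow> 0) at_top"
      by (intro tendsto_mult_right_zero)
  qed
qed

lemma airy_ray_has_vector_derivative: "(airy_ray \<eta> has_vector_derivative 1 + \<i>) (at r)"
  unfolding airy_ray_def[abs_def]
  by (auto intro!: derivative_eq_intros simp: has_vector_derivative_def scaleR_conv_of_real mult.commute)

lemma airy_kernel_has_field_derivative:
  "(airy_kernel x has_field_derivative \<i> * (s\<^sup>2 + of_real x) * airy_kernel x s) (at s)"
  unfolding airy_kernel_def[abs_def]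
  by (rule derivative_eq_intros refl | simp add: algebra_simps)+

text \<open>The function \<open>(s\<^sup>2 + x) * airy_kernel x s\<close> is the derivative of
  \<open>- \<i> * airy_kernel x s\<close>, so the integral along the ray reduces to a boundary term
  at its start. There the kernel is real, because the start lies on the imaginary axis, so the
  boundary term is purely imaginary and vanishes on taking real parts. This is the source of the
  Airy equation.\<close>

lemma airy_moment_2:
  "(1 + \<i>) * (airy_moment 2 \<eta> x + of_real x * airy_moment 0 \<eta> x) = \<i> * of_real (exp (\<eta> ^ 3 / 3 - x * \<eta>))"
proof -
  let ?s = "airy_ray \<eta>"
  let ?f = "\<lambda>r. (1 + \<i>) * (?s r ^ 2 * airy_kernel x (?s r)) + (1 + \<i>) * of_real x * (?s r ^ 0 * airy_kernel x (?s r))"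
  let ?F = "\<lambda>r. - \<i> * airy_kernel x (?s r)"
  note int = set_integrable_airy_moment
  have "(1 + \<i>) * (airy_moment 2 \<eta> x + of_real x * airy_moment 0 \<eta> x) =
      (1 + \<i>) * airy_moment 2 \<eta> x + (1 + \<i>) * of_real x * airy_moment 0 \<eta> x"
    by (simp add: algebra_simps)
  also have "\<dots> = (LINT r:{0..}|lborel. ?f r)"
    unfolding airy_moment_def set_integral_mult_right[symmetric]
    by (subst set_integral_add(2)[symmetric] | intro set_integral_add set_integrable_mult_right int refl)+
  also have "\<dots> = - \<i> * 0 - ?F 0"
  proof -
    have "set_integrable lborel {0..} ?f"
      by (intro set_integral_add set_integrable_mult_right int)
    moreover have "(?F has_vector_derivative ?f r) (at r)" for r
      using field_vector_diff_chain_at[OF airy_ray_has_vector_derivative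
          DERIV_cmult[OF airy_kernel_has_field_derivative, of "- \<i>"], of x \<eta> r]
      by (simp add: o_def algebra_simps)
    ultimately have "(?F \<longlongrightarrow> ?F 0 + (LINT r:{0..}|lborel. ?f r)) at_top"
      by (intro set_integral_atLeast_tendsto) simp_all
    moreover have "(?F \<longlongrightarrow> - \<i> * 0) at_top"
      by (intro tendsto_intros airy_kernel_ray_tendsto_0)
    ultimately have "?F 0 + (LINT r:{0..}|lborel. ?f r) = - \<i> * 0"
      by (intro tendsto_unique[of at_top]) auto
    then show ?thesis by (simp add: algebra_simps)
  qed
  also have "airy_kernel x (?s 0) = of_real (exp (\<eta> ^ 3 / 3 - x * \<eta>))"
    unfolding airy_kernel_def airy_phase_ray by (simp flip: complex_of_real_def exp_of_real)
  finally show ?thesis by simp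
qed

section \<open>The Airy function as a contour integral\<close>

lemma norm_airy_kernel:
  "norm (airy_kernel x (Complex u v)) = exp (v ^ 3 / 3 - u\<^sup>2 * v - x * v)"
  unfolding airy_kernel_def norm_exp_eq_Re
  by (simp add: power3_eq_cube power2_eq_square field_simps)

text \<open>The point of the ray above the real point \<open>R\<close> is
  \<open>R + \<i> * (R + \<eta>)\<close>, so this vertical segment closes the contour between the
  ray and the real axis. On it the kernel decays like \<open>exp (- c * y)\<close> with
  \<open>c\<close> of order \<open>R\<^sup>2\<close>, and the integral is at most
  \<open>1 / c\<close>.\<close>

lemma airy_primitive_vertical:
  assumes F: "\<And>z. (F has_field_derivative airy_kernel x z) (at z)"
  shows "((\<lambda>R. F (airy_ray \<eta> R) - F (of_real R)) \<longlongrightarrow> 0) at_top"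
proof (rule Lim_null_comparison)
  have "\<forall>\<^sub>F R in at_top. R + \<eta> > 0" by real_asymp
  moreover have "\<forall>\<^sub>F R in at_top. (R + \<eta>)\<^sup>2 \<le> 2 * R\<^sup>2" by real_asymp
  moreover have "\<forall>\<^sub>F R in at_top. - x \<le> R\<^sup>2 / 6" by real_asymp
  ultimately show "\<forall>\<^sub>F R in at_top. norm (F (airy_ray \<eta> R) - F (of_real R)) \<le> 6 / R\<^sup>2"
    using eventually_gt_at_top[of 0]
  proof eventually_elim
    case (elim R)
    \<comment> \<open>The exponent per unit height is at most
      \<open>y\<^sup>2 / 3 - R\<^sup>2 - x\<close>. For large \<open>R\<close> this is bounded by
      2/3 - 1 + 1/6 = - 1/6 times \<open>R\<^sup>2\<close>.\<close>
    define c where "c = R\<^sup>2 / 6"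
    have c: "c > 0" using elim by (simp add: c_def)
    let ?g = "\<lambda>y. F (Complex R y)" and ?\<phi> = "\<lambda>y. - (exp (- c * y) / c)"
    have dg: "(?g has_vector_derivative \<i> * airy_kernel x (Complex R y)) (at y)" for y
    proof -
      have "((\<lambda>y. Complex R y) has_vector_derivative \<i>) (at y)"
        unfolding Complex_eq
        by (auto intro!: derivative_eq_intros simp: has_vector_derivative_def scaleR_conv_of_real mult.commute)
      from field_vector_diff_chain_at[OF this F] show ?thesis by (simp add: o_def)
    qed
    have d\<phi>: "(?\<phi> has_vector_derivative exp (- c * y)) (at y)" for y
      unfolding has_real_derivative_iff_has_vector_derivative[symmetric]
      using c by (auto intro!: derivative_eq_intros)
    have "norm (?g (R + \<eta>) - ?g 0) \<le> ?\<phi> (R + \<eta>) - ?\<phi> 0"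
    proof (rule differentiable_bound_general)
      show "0 < R + \<eta>" using elim by simp
      show "continuous_on {0..R + \<eta>} ?g"
        using dg by (intro continuous_at_imp_continuous_on ballI) (blast intro: has_vector_derivative_continuous)
      show "continuous_on {0..R + \<eta>} ?\<phi>" using c by (intro continuous_intros) auto
      fix y assume y: "0 < y" "y < R + \<eta>"
      show "(?g has_vector_derivative \<i> * airy_kernel x (Complex R y)) (at y)" by (rule dg)
      show "(?\<phi> has_vector_derivative exp (- c * y)) (at y)" by (rule d\<phi>)
      have "y\<^sup>2 \<le> (R + \<eta>)\<^sup>2" using y by (intro power_mono) auto
      then have "y\<^sup>2 \<le> 2 * R\<^sup>2" using elim by linarith
      then have "y\<^sup>2 / 3 - R\<^sup>2 - x \<le> - c" using elim c_def by linarith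
      then have "(y\<^sup>2 / 3 - R\<^sup>2 - x) * y \<le> - c * y" using y by (intro mult_right_mono) auto
      then show "norm (\<i> * airy_kernel x (Complex R y)) \<le> exp (- c * y)"
        by (simp add: norm_mult norm_airy_kernel algebra_simps power2_eq_square power3_eq_cube)
    qed
    also have "\<dots> \<le> 6 / R\<^sup>2" using c by (simp add: c_def)
    finally have "norm (?g (R + \<eta>) - ?g 0) \<le> 6 / R\<^sup>2" .
    moreover have "airy_ray \<eta> R = Complex R (R + \<eta>)"
      by (simp add: airy_ray_def complex_eq_iff)
    ultimately show ?case by (simp add: complex_of_real_def)
  qed
  show "((\<lambda>R::real. 6 / R\<^sup>2) \<longlongrightarrow> 0) at_top" by real_asymp
qed

text \<open>The start point of the ray may slide along the imaginary axis: the integrand is real there, so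
  the piece of the contour between two start points contributes a purely imaginary number.\<close>

lemma Airy_Ai_eq_moment: "Airy_Ai x = Re ((1 + \<i>) * airy_moment 0 \<eta> x) / pi"
proof -
  \<comment> \<open>A primitive of the entire kernel replaces Cauchy's theorem: moving the contour
    becomes a comparison of values of \<open>F\<close> at the ends.\<close>
  have "airy_kernel x holomorphic_on UNIV"
    unfolding airy_kernel_def[abs_def] by (intro holomorphic_intros) simp
  then obtain F where F: "\<And>z. (F has_field_derivative airy_kernel x z) (at z)"
    using holomorphic_convex_primitive'[OF convex_UNIV open_UNIV] by auto
  let ?s = "airy_ray \<eta>" and ?M = "(1 + \<i>) * airy_moment 0 \<eta> x"
  have "set_integrable lborel {0..} (\<lambda>r. (1 + \<i>) * (?s r ^ 0 * airy_kernel x (?s r)))"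
    by (intro set_integrable_mult_right set_integrable_airy_moment)
  moreover have "((\<lambda>r. F (?s r)) has_vector_derivative (1 + \<i>) * (?s r ^ 0 * airy_kernel x (?s r))) (at r)" for r
    using field_vector_diff_chain_at[OF airy_ray_has_vector_derivative F] by (simp add: o_def)
  ultimately have ray: "((\<lambda>R. F (?s R)) \<longlongrightarrow> F (?s 0) + ?M) at_top"
    unfolding airy_moment_def set_integral_mult_right[symmetric]
    by (intro set_integral_atLeast_tendsto)

  have Re_im: "Re (F (?s 0)) = Re (F 0)"
  proof -
    have "((\<lambda>u. Re (F (\<i> * of_real u))) has_real_derivative 0) (at u)" for u
    proof -
      have "((\<lambda>u. \<i> * of_real u) has_vector_derivative \<i>) (at u)"
        by (auto intro!: derivative_eq_intros simp: has_vector_derivative_def scaleR_conv_of_real mult.commute)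
      from field_vector_diff_chain_at[OF this F]
      have "((\<lambda>u. F (\<i> * of_real u)) has_vector_derivative \<i> * airy_kernel x (\<i> * of_real u)) (at u)"
        by (simp add: o_def)
      then have "((\<lambda>u. Re (F (\<i> * of_real u))) has_real_derivative Re (\<i> * airy_kernel x (\<i> * of_real u))) (at u)"
        by (rule has_field_derivative_Re)
      moreover have "airy_kernel x (\<i> * of_real u) = of_real (exp (u ^ 3 / 3 - x * u))"
        by (simp add: airy_kernel_def power_mult_distrib power3_eq_cube algebra_simps flip: exp_of_real)
      ultimately show ?thesis by simp
    qed
    then have "Re (F (\<i> * of_real \<eta>)) = Re (F (\<i> * of_real 0))"
      by (intro DERIV_isconst_all) auto
    then show ?thesis by (simp add: airy_ray_def)
  qed

  let ?f = "\<lambda>s::real. cos (s ^ 3 / 3 + x * s)"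
  have line: "(?f has_integral Re (F (of_real R)) - Re (F 0)) {0..R}" if "R \<ge> 0" for R
  proof -
    have "((\<lambda>s. Re (F (of_real s))) has_vector_derivative ?f s) (at s)" for s
    proof -
      have "((\<lambda>s. of_real s) has_vector_derivative (1::complex)) (at s)"
        by (auto intro!: derivative_eq_intros simp: has_vector_derivative_def scaleR_conv_of_real)
      from field_vector_diff_chain_at[OF this F]
      have "((\<lambda>s. F (of_real s)) has_vector_derivative airy_kernel x (of_real s)) (at s)"
        by (simp add: o_def)
      then have "((\<lambda>s. Re (F (of_real s))) has_real_derivative Re (airy_kernel x (of_real s))) (at s)"
        by (rule has_field_derivative_Re)
      moreover have "airy_kernel x (of_real s) = cis (s ^ 3 / 3 + x * s)"
        by (simp add: airy_kernel_def cis_conv_exp)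
      ultimately show ?thesis
        by (simp add: has_real_derivative_iff_has_vector_derivative)
    qed
    then show ?thesis
      using that fundamental_theorem_of_calculus[of 0 R "\<lambda>s. Re (F (of_real s))" ?f]
      by (auto intro: has_vector_derivative_at_within)
  qed

  \<comment> \<open>Absolute convergence yields a limit only along the ray, so
    \<open>F (of_real R)\<close> is written as \<open>F (?s R)\<close> minus the vertical gap. The
    \<open>Re 0\<close> in the limit is that gap.\<close>
  have "((\<lambda>R. Re (F (?s R)) - Re (F (?s R) - F (of_real R)) - Re (F 0))
      \<longlongrightarrow> Re (F (?s 0) + ?M) - Re 0 - Re (F 0)) at_top"
    by (intro tendsto_intros ray airy_primitive_vertical[OF F])
  moreover have "\<forall>\<^sub>F R in at_top. Re (F (?s R)) - Re (F (?s R) - F (of_real R)) - Re (F 0) = integral {0..R} ?f"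
    using eventually_ge_at_top[of 0]
    by eventually_elim (simp add: integral_unique[OF line])
  ultimately have "((\<lambda>R. integral {0..R} ?f) \<longlongrightarrow> Re (F (?s 0) + ?M) - Re 0 - Re (F 0)) at_top"
    by (rule Lim_transform_eventually)
  then have "((\<lambda>R. integral {0..R} ?f) \<longlongrightarrow> Re ?M) at_top"
    using Re_im by simp
  then have "(?f has_integral Re ?M) {0..}"
    by (intro has_integral_improper integrable_continuous_real continuous_intros) simp
  then show ?thesis
    by (simp add: Airy_Ai_def integral_unique)
qed

section \<open>The Airy equation, and decay on the positive axis\<close>

lemma Re_airy_moment_has_derivative:
  "((\<lambda>x. Re (c * airy_moment k \<eta> x) / pi) has_real_derivative
     Re (c * \<i> * airy_moment (Suc k) \<eta> x) / pi) (at x)"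
proof -
  have "((\<lambda>x. c * airy_moment k \<eta> x) has_vector_derivative c * (\<i> * airy_moment (Suc k) \<eta> x)) (at x)"
    by (rule has_vector_derivative_mult_right[OF airy_moment_has_vector_derivative])
  then have "((\<lambda>x. Re (c * airy_moment k \<eta> x)) has_real_derivative
      Re (c * (\<i> * airy_moment (Suc k) \<eta> x))) (at x)"
    by (rule has_field_derivative_Re)
  from DERIV_cdivide[OF this] show ?thesis by (simp only: mult.assoc)
qed

text \<open>Every \<open>\<eta>\<close> represents the same function, so by uniqueness of the
  derivative the formula for it holds along every ray. This freedom is needed: the decay estimate
  takes \<open>\<eta> = 1\<close>, the saddle point takes a start that moves with
  \<open>x\<close>.\<close>

lemma deriv_Airy_Ai_eq_moment: "deriv Airy_Ai x = Re ((1 + \<i>) * \<i> * airy_moment 1 \<eta> x) / pi"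
  and Airy_Ai_has_derivative: "(Airy_Ai has_real_derivative deriv Airy_Ai x) (at x)"
proof -
  have *: "Airy_Ai = (\<lambda>x. Re ((1 + \<i>) * airy_moment 0 \<eta> x) / pi)" for \<eta>
    using Airy_Ai_eq_moment by blast
  have "(Airy_Ai has_real_derivative Re ((1 + \<i>) * \<i> * airy_moment 1 \<eta> x) / pi) (at x)" for \<eta>
    by (subst *[of \<eta>]) (use Re_airy_moment_has_derivative[of "1 + \<i>" 0 \<eta> x] in simp)
  then show "deriv Airy_Ai x = Re ((1 + \<i>) * \<i> * airy_moment 1 \<eta> x) / pi"
    "(Airy_Ai has_real_derivative deriv Airy_Ai x) (at x)"
    using DERIV_imp_deriv by metis+
qed

lemma deriv_Airy_Ai_has_derivative: "(deriv Airy_Ai has_real_derivative x * Airy_Ai x) (at x)"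
proof -
  have *: "deriv Airy_Ai = (\<lambda>x. Re ((1 + \<i>) * \<i> * airy_moment 1 0 x) / pi)"
    using deriv_Airy_Ai_eq_moment by blast
  have "(deriv Airy_Ai has_real_derivative Re ((1 + \<i>) * \<i> * \<i> * airy_moment 2 0 x) / pi) (at x)"
    by (subst *) (use Re_airy_moment_has_derivative[of "(1 + \<i>) * \<i>" 1 0 x] in \<open>simp add: numeral_2_eq_2\<close>)
  moreover have "Re ((1 + \<i>) * \<i> * \<i> * airy_moment 2 0 x) = x * Re ((1 + \<i>) * airy_moment 0 0 x)"
    using arg_cong[OF airy_moment_2[of 0 x], of Re] by (simp add: algebra_simps)
  ultimately show ?thesis by (simp add: Airy_Ai_eq_moment[of x 0])
qed

text \<open>On the ray from i, the modulus of the kernel at \<open>x\<close> is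
  \<open>exp (- x * (1 + r))\<close> times that at 0. The start height 1 is what yields the factor
  \<open>exp (- x)\<close>, and the constant is an integral at \<open>x = 0\<close>, enlarged by 1
  to be positive.\<close>

lemma norm_airy_moment_decay:
  obtains C where "C > 0" "\<And>x. x \<ge> 0 \<Longrightarrow> norm (airy_moment k 1 x) \<le> C * exp (- x)"
proof -
  let ?s = "airy_ray 1" and ?D = "LINT r:{0..}|lborel. norm (airy_ray 1 r ^ k * airy_kernel 0 (airy_ray 1 r))"
  note int = set_integrable_airy_moment[of 1 k]
  have "norm (airy_moment k 1 x) \<le> (?D + 1) * exp (- x)" if x: "x \<ge> 0" for x
  proof -
    have "norm (airy_moment k 1 x) \<le> (LINT r:{0..}|lborel. norm (?s r ^ k * airy_kernel x (?s r)))"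
      unfolding airy_moment_def by (rule set_integral_norm_bound[OF int])
    also have "\<dots> \<le> (LINT r:{0..}|lborel. exp (- x) * norm (?s r ^ k * airy_kernel 0 (?s r)))"
    proof (intro set_integral_mono set_integrable_mult_right set_integrable_norm int)
      fix r :: real assume "r \<in> {0..}"
      then have "norm (airy_kernel x (?s r)) \<le> exp (- x) * norm (airy_kernel 0 (?s r))"
        using x by (simp add: norm_airy_kernel_ray algebra_simps flip: exp_add)
      from mult_left_mono[OF this norm_ge_zero[of "?s r ^ k"]]
      show "norm (?s r ^ k * airy_kernel x (?s r)) \<le> exp (- x) * norm (?s r ^ k * airy_kernel 0 (?s r))"
        by (simp add: norm_mult mult.left_commute)
    qed
    also have "\<dots> = ?D * exp (- x)" by simp
    also have "\<dots> \<le> (?D + 1) * exp (- x)" by (simp add: algebra_simps)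
    finally show ?thesis .
  qed
  moreover have "?D \<ge> 0"
    unfolding set_lebesgue_integral_def by (intro Bochner_Integration.integral_nonneg) simp
  ultimately show ?thesis using that[of "?D + 1"] by simp
qed

lemma Airy_Ai_decay:
  obtains C where "C > 0" "\<And>x. x \<ge> 0 \<Longrightarrow> \<bar>Airy_Ai x\<bar> \<le> C * exp (- x)"
    "\<And>x. x \<ge> 0 \<Longrightarrow> \<bar>deriv Airy_Ai x\<bar> \<le> C * exp (- x)"
proof -
  obtain C0 where C0: "C0 > 0" "\<And>x. x \<ge> 0 \<Longrightarrow> norm (airy_moment 0 1 x) \<le> C0 * exp (- x)"
    using norm_airy_moment_decay by blast
  obtain C1 where C1: "C1 > 0" "\<And>x. x \<ge> 0 \<Longrightarrow> norm (airy_moment 1 1 x) \<le> C1 * exp (- x)"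
    using norm_airy_moment_decay by blast
  \<comment> \<open>The prefactors of both representations have modulus at most 2 and are outweighed
    by the division by \<open>pi\<close>.\<close>
  have *: "\<bar>Re (c * z) / pi\<bar> \<le> norm z" if "norm c \<le> 2" for c z
  proof -
    have "\<bar>Re (c * z)\<bar> \<le> norm c * norm z" by (metis abs_Re_le_cmod norm_mult)
    also have "\<dots> \<le> pi * norm z" using that pi_gt3 by (intro mult_right_mono) auto
    finally show ?thesis by (simp add: abs_divide divide_simps mult.commute)
  qed
  have n2: "norm (1 + \<i>) \<le> 2" using norm_triangle_ineq[of 1 \<i>] by simp
  show ?thesis
  proof (rule that[of "max C0 C1"])
    show "max C0 C1 > 0" using C0 by simp
    fix x :: real assume x: "x \<ge> 0"
    have "\<bar>Airy_Ai x\<bar> \<le> norm (airy_moment 0 1 x)"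
      unfolding Airy_Ai_eq_moment[of x 1] by (rule *[OF n2])
    also have "\<dots> \<le> C0 * exp (- x)" by (rule C0(2)[OF x])
    also have "\<dots> \<le> max C0 C1 * exp (- x)" by simp
    finally show "\<bar>Airy_Ai x\<bar> \<le> max C0 C1 * exp (- x)" .
    have "\<bar>deriv Airy_Ai x\<bar> \<le> norm (airy_moment 1 1 x)"
      unfolding deriv_Airy_Ai_eq_moment[of x 1] by (rule *) (use n2 in \<open>simp add: norm_mult\<close>)
    also have "\<dots> \<le> C1 * exp (- x)" by (rule C1(2)[OF x])
    also have "\<dots> \<le> max C0 C1 * exp (- x)" by simp
    finally show "\<bar>deriv Airy_Ai x\<bar> \<le> max C0 C1 * exp (- x)" .
  qed
qed

section \<open>The energy\<close>

text \<open>This is the diagonal of the Airy kernel of random matrix theory, the density of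
  eigenvalues at a soft edge. Its growth like \<open>sqrt y / pi\<close> at \<open>- y\<close> is
  the square root profile of the semicircle density near its edge.\<close>

definition airy_energy :: "real \<Rightarrow> real" where
  "airy_energy x = (deriv Airy_Ai x)\<^sup>2 - x * (Airy_Ai x)\<^sup>2"

lemma airy_energy_has_derivative: "(airy_energy has_real_derivative - (Airy_Ai x)\<^sup>2) (at x)"
  unfolding airy_energy_def[abs_def]
  by (rule derivative_eq_intros Airy_Ai_has_derivative deriv_Airy_Ai_has_derivative refl
      | simp add: power2_eq_square algebra_simps)+

lemma airy_energy_decay:
  obtains C where "C > 0" "\<And>x. x \<ge> 0 \<Longrightarrow> \<bar>airy_energy x\<bar> \<le> C * exp (- x)"
proof -
  obtain C where C: "C > 0" "\<And>x. x \<ge> 0 \<Longrightarrow> \<bar>Airy_Ai x\<bar> \<le> C * exp (- x)"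
    "\<And>x. x \<ge> 0 \<Longrightarrow> \<bar>deriv Airy_Ai x\<bar> \<le> C * exp (- x)"
    using Airy_Ai_decay by blast
  have "\<bar>airy_energy x\<bar> \<le> C\<^sup>2 * exp (- x)" if x: "x \<ge> 0" for x
  proof -
    have sq: "(Airy_Ai x)\<^sup>2 \<le> (C * exp (- x))\<^sup>2" "(deriv Airy_Ai x)\<^sup>2 \<le> (C * exp (- x))\<^sup>2"
      using power_mono[OF C(2)[OF x], of 2] power_mono[OF C(3)[OF x], of 2] by simp_all
    have "\<bar>airy_energy x\<bar> \<le> (deriv Airy_Ai x)\<^sup>2 + x * (Airy_Ai x)\<^sup>2"
      unfolding airy_energy_def using x by (simp add: abs_le_iff)
    also have "\<dots> \<le> (C * exp (- x))\<^sup>2 + x * (C * exp (- x))\<^sup>2"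
      using sq x by (intro add_mono mult_left_mono)
    \<comment> \<open>Squaring produces \<open>exp (- x)\<close> twice, and one of the two factors
      absorbs the polynomial \<open>1 + x\<close>.\<close>
    also have "\<dots> = C\<^sup>2 * exp (- x) * ((1 + x) * exp (- x))"
      by (simp add: power2_eq_square algebra_simps)
    also have "\<dots> \<le> C\<^sup>2 * exp (- x) * 1"
    proof (rule mult_left_mono)
      have "(1 + x) * exp (- x) \<le> exp x * exp (- x)"
        by (intro mult_right_mono exp_ge_add_one_self) simp
      then show "(1 + x) * exp (- x) \<le> 1" by (simp flip: exp_add)
    qed simp
    finally show ?thesis by simp
  qed
  with that[of "C\<^sup>2"] C show ?thesis by simp
qed

section \<open>Saddle point asymptotics of the energy\<close>

text \<open>In the variable \<open>s = p\<^sup>2 * (1 + (1 + \<i>) * \<rho> / p ^ 3)\<close> the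
  phase at \<open>x = - p ^ 4\<close> equals its saddle value plus exactly the exponent written
  here. The phase is a cubic polynomial, so its expansion at the saddle ends with the third order
  and the rescaling makes no error.\<close>

definition saddle_integrand :: "nat \<Rightarrow> real \<Rightarrow> real \<Rightarrow> complex" where
  "saddle_integrand k p \<rho> = (1 + (1 + \<i>) * of_real (\<rho> / p ^ 3)) ^ k *
     exp (- 2 * of_real (\<rho>\<^sup>2) - (2 + 2 * \<i>) * of_real (\<rho> ^ 3 / (3 * p ^ 3)))"

definition saddle_integral :: "nat \<Rightarrow> real \<Rightarrow> complex" where
  "saddle_integral k p = (LINT \<rho>:{- (p ^ 3)..}|lborel. saddle_integrand k p \<rho>)"

text \<open>At \<open>x = -p\<^sup>4\<close> the phase has the saddle point \<open>s = p\<^sup>2\<close>, through which the ray passes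
  when it starts at \<open>-\<i> p\<^sup>2\<close>; the rescaling \<open>r = p\<^sup>2 + \<rho> / p\<close> normalises the Gaussian there.\<close>

lemma airy_moment_saddle:
  assumes p: "p > 0"
  shows "airy_moment k (- (p\<^sup>2)) (- (p ^ 4)) =
    of_real (p ^ (2 * k) / p) * exp (- (2 * \<i> * of_real (p ^ 6) / 3)) * saddle_integral k p"
proof -
  let ?s = "airy_ray (- (p\<^sup>2))"
  let ?f = "\<lambda>r. indicator {0..} r *\<^sub>R (?s r ^ k * airy_kernel (- (p ^ 4)) (?s r))"
  let ?c = "of_real (p ^ (2 * k)) * exp (- (2 * \<i> * of_real (p ^ 6) / 3))"
  have "?f (p\<^sup>2 + 1 / p * \<rho>) = ?c * (indicator {- (p ^ 3)..} \<rho> *\<^sub>R saddle_integrand k p \<rho>)" for \<rho>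
  proof -
    have ind: "indicat_real {0..} (p\<^sup>2 + 1 / p * \<rho>) = indicator {- (p ^ 3)..} \<rho>"
      using p by (auto simp: indicator_def field_simps power2_eq_square power3_eq_cube)
    define \<tau> where "\<tau> = \<rho> / p ^ 3"
    have \<rho>: "\<rho> = p ^ 3 * \<tau>" using p by (simp add: \<tau>_def)
    have s: "?s (p\<^sup>2 + 1 / p * \<rho>) = of_real (p\<^sup>2) * (1 + (1 + \<i>) * of_real \<tau>)"
      using p unfolding airy_ray_def \<rho>
      by (simp add: complex_eq_iff power2_eq_square power3_eq_cube field_simps)
    have "\<i> * (?s (p\<^sup>2 + 1 / p * \<rho>) ^ 3 / 3 + of_real (- (p ^ 4)) * ?s (p\<^sup>2 + 1 / p * \<rho>)) =
        - (2 * \<i> * of_real (p ^ 6) / 3) +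
        (- 2 * of_real (\<rho>\<^sup>2) - (2 + 2 * \<i>) * of_real (\<rho> ^ 3 / (3 * p ^ 3)))"
    proof -
      have c1: "\<rho>\<^sup>2 = p ^ 6 * \<tau>\<^sup>2" and c2: "\<rho> ^ 3 / (3 * p ^ 3) = p ^ 6 * \<tau> ^ 3 / 3"
        using p unfolding \<rho> by (simp_all add: power_mult_distrib flip: power_mult) (simp add: eval_nat_numeral)
      have "?s (p\<^sup>2 + 1 / p * \<rho>) ^ 3 / 3 + of_real (- (p ^ 4)) * ?s (p\<^sup>2 + 1 / p * \<rho>)
          = of_real (p ^ 6) * ((1 + (1 + \<i>) * of_real \<tau>) ^ 3 / 3 - (1 + (1 + \<i>) * of_real \<tau>))"
        unfolding s power_mult_distrib by (simp add: algebra_simps flip: power_mult power_add)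
      \<comment> \<open>With z = (1 + i) \<tau> this is - 2/3 + z^2 + z^3 / 3. The linear term is
        absent because of the saddle, and the remaining factor i makes the quadratic term real and
        negative.\<close>
      also have "(1 + (1 + \<i>) * of_real \<tau>) ^ 3 / 3 - (1 + (1 + \<i>) * of_real \<tau>)
          = - 2 / 3 + 2 * \<i> * of_real (\<tau>\<^sup>2) + (- 2 + 2 * \<i>) * of_real (\<tau> ^ 3) / 3"
        by (simp add: complex_eq_iff power2_eq_square power3_eq_cube field_simps)
      finally have phase: "?s (p\<^sup>2 + 1 / p * \<rho>) ^ 3 / 3 + of_real (- (p ^ 4)) * ?s (p\<^sup>2 + 1 / p * \<rho>)
          = of_real (p ^ 6) * (- 2 / 3 + 2 * \<i> * of_real (\<tau>\<^sup>2) + (- 2 + 2 * \<i>) * of_real (\<tau> ^ 3) / 3)" .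
      show ?thesis
        unfolding phase c1 c2 by (simp add: field_simps)
    qed
    then have "airy_kernel (- (p ^ 4)) (?s (p\<^sup>2 + 1 / p * \<rho>)) = exp (- (2 * \<i> * of_real (p ^ 6) / 3)) *
        exp (- 2 * of_real (\<rho>\<^sup>2) - (2 + 2 * \<i>) * of_real (\<rho> ^ 3 / (3 * p ^ 3)))"
      unfolding airy_kernel_def by (simp only: exp_add)
    moreover have "?s (p\<^sup>2 + 1 / p * \<rho>) ^ k = of_real (p ^ (2 * k)) * (1 + (1 + \<i>) * of_real (\<rho> / p ^ 3)) ^ k"
      unfolding s power_mult_distrib \<tau>_def by (simp flip: power_mult)
    ultimately show ?thesis
      unfolding ind saddle_integrand_def by (simp only: scaleR_conv_of_real mult_ac)
  qed
  then have "airy_moment k (- (p\<^sup>2)) (- (p ^ 4)) =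
      \<bar>1 / p\<bar> *\<^sub>R (\<integral>\<rho>. ?c * (indicator {- (p ^ 3)..} \<rho> *\<^sub>R saddle_integrand k p \<rho>) \<partial>lborel)"
    unfolding airy_moment_def set_lebesgue_integral_def
    using p by (subst lborel_integral_real_affine[where c = "1 / p" and t = "p\<^sup>2"]) simp_all
  then show ?thesis
    using p by (simp add: saddle_integral_def set_lebesgue_integral_def scaleR_conv_of_real)
qed

lemma has_bochner_integral_exp_neg_2_sq:
  "has_bochner_integral lborel (\<lambda>\<rho>. exp (- 2 * of_real (\<rho>\<^sup>2)) :: complex) (of_real (sqrt (pi / 2)))"
proof -
  \<comment> \<open>Standard deviation 1/2 is the one whose normal density has exponent
    \<open>- 2 * \<rho>\<^sup>2\<close>.\<close>
  have eq: "exp (- 2 * \<rho>\<^sup>2) = sqrt (pi / 2) * normal_density 0 (1 / 2) \<rho>" for \<rho> :: real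
    by (simp add: normal_density_def power2_eq_square real_sqrt_divide field_simps)
  have "has_bochner_integral lborel (\<lambda>\<rho>::real. sqrt (pi / 2) * normal_density 0 (1 / 2) \<rho>) (sqrt (pi / 2) * 1)"
    by (intro has_bochner_integral_mult_right)
       (use integral_normal_density[of "1/2" 0] integrable_normal_density[of "1/2" 0] in
         \<open>simp add: has_bochner_integral_iff\<close>)
  then have "has_bochner_integral lborel (\<lambda>\<rho>. complex_of_real (exp (- 2 * \<rho>\<^sup>2))) (of_real (sqrt (pi / 2)))"
    unfolding eq by (intro has_bochner_integral_of_real) simp
  then show ?thesis by (simp flip: exp_of_real)
qed

text \<open>A majorant independent of \<open>p\<close>. The cubic term has the wrong sign for
  negative \<open>\<rho>\<close>, but the integration starts at \<open>- (p ^ 3)\<close>, where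
  \<open>- (\<rho> ^ 3) \<le> p ^ 3 * \<rho>\<^sup>2\<close> still holds. Hence it uses up at most
  2/3 of the coefficient 2 of the Gaussian exponent, and 4/3 remains.\<close>

lemma norm_saddle_integrand_le:
  assumes p: "p \<ge> 1" and \<rho>: "\<rho> \<ge> - (p ^ 3)"
  shows "norm (saddle_integrand k p \<rho>) \<le> exp (3 * (real k)\<^sup>2 - \<rho>\<^sup>2 / 2)"
proof -
  have p0: "p > 0" using p by linarith
  have p3: "p ^ 3 \<ge> 1" using p by simp
  have "norm (1 + (1 + \<i>) * of_real (\<rho> / p ^ 3)) \<le> 1 + 2 * \<bar>\<rho>\<bar>"
  proof -
    have "norm (1 + (1 + \<i>) * of_real (\<rho> / p ^ 3)) \<le> 1 + norm (1 + \<i>) * \<bar>\<rho> / p ^ 3\<bar>"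
      by (intro order_trans[OF norm_triangle_ineq]) (simp only: norm_mult norm_of_real norm_one order_refl)
    also have "\<dots> \<le> 1 + 2 * \<bar>\<rho>\<bar>"
    proof (intro add_left_mono mult_mono)
      show "norm (1 + \<i>) \<le> 2" using norm_triangle_ineq[of 1 \<i>] by simp
      have "\<bar>\<rho>\<bar> / p ^ 3 \<le> \<bar>\<rho>\<bar> / 1" using p0 p3 by (intro divide_left_mono) auto
      then show "\<bar>\<rho> / p ^ 3\<bar> \<le> \<bar>\<rho>\<bar>" using p3 by simp
    qed auto
    finally show ?thesis .
  qed
  also have "\<dots> \<le> exp (2 * \<bar>\<rho>\<bar>)" by (rule exp_ge_add_one_self)
  finally have "norm (1 + (1 + \<i>) * of_real (\<rho> / p ^ 3)) ^ k \<le> exp (2 * \<bar>\<rho>\<bar>) ^ k"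
    by (intro power_mono) auto
  also have "\<dots> = exp (2 * k * \<bar>\<rho>\<bar>)"
    by (simp add: algebra_simps flip: exp_of_nat_mult)
  finally have 1: "norm (1 + (1 + \<i>) * of_real (\<rho> / p ^ 3)) ^ k \<le> exp (2 * k * \<bar>\<rho>\<bar>)" .
  have "- (\<rho> ^ 3) \<le> p ^ 3 * \<rho>\<^sup>2"
    using mult_right_mono[OF \<rho>, of "\<rho>\<^sup>2"] by (simp add: power2_eq_square power3_eq_cube mult.assoc)
  then have "- 2 * \<rho>\<^sup>2 - 2 * (\<rho> ^ 3 / (3 * p ^ 3)) \<le> - (4 / 3) * \<rho>\<^sup>2"
    using p0 p3 by (simp add: field_simps)
  then have 2: "norm (exp (- 2 * of_real (\<rho>\<^sup>2) - (2 + 2 * \<i>) * of_real (\<rho> ^ 3 / (3 * p ^ 3)))) \<le> exp (- (4 / 3) * \<rho>\<^sup>2)"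
    by (simp add: norm_exp_eq_Re)
  have "norm (saddle_integrand k p \<rho>) \<le> exp (2 * k * \<bar>\<rho>\<bar>) * exp (- (4 / 3) * \<rho>\<^sup>2)"
    unfolding saddle_integrand_def norm_mult norm_power using 1 2 by (intro mult_mono) auto
  also have "\<dots> \<le> exp (3 * (real k)\<^sup>2 - \<rho>\<^sup>2 / 2)"
  proof -
    \<comment> \<open>This square is weighted so that the linear exponent costs only 1/3 of
      \<open>\<rho>\<^sup>2\<close>. Of the coefficient 4/3 more than 1/2 is left, and 1/2 matches
      the standard normal density.\<close>
    have "0 \<le> (3 * k - \<bar>\<rho>\<bar>)\<^sup>2" by simp
    then have "2 * k * \<bar>\<rho>\<bar> \<le> 3 * (real k)\<^sup>2 + \<rho>\<^sup>2 / 3"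
      by (simp add: power2_eq_square algebra_simps)
    then have "2 * k * \<bar>\<rho>\<bar> + (- (4 / 3) * \<rho>\<^sup>2) \<le> 3 * (real k)\<^sup>2 - \<rho>\<^sup>2 / 2"
      using zero_le_power2[of \<rho>] by linarith
    then show ?thesis by (simp flip: exp_add)
  qed
  finally show ?thesis .
qed

text \<open>For fixed \<open>\<rho>\<close> the \<open>k\<close>-th power tends to 1, so the limit
  does not depend on \<open>k\<close>. The Airy function (\<open>k = 0\<close>) and its derivative
  (\<open>k = 1\<close>) thus share one Gaussian constant, on which the cancellation of the
  oscillations rests.\<close>

lemma saddle_integral_tendsto: "(saddle_integral k \<longlongrightarrow> of_real (sqrt (pi / 2))) at_top"
proof -
  let ?g = "\<lambda>\<rho>::real. exp (- 2 * of_real (\<rho>\<^sup>2)) :: complex"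
  let ?w = "\<lambda>\<rho>::real. exp (3 * (real k)\<^sup>2 - \<rho>\<^sup>2 / 2)"
  have [measurable]: "saddle_integrand k p \<in> borel_measurable borel" for p
    unfolding saddle_integrand_def[abs_def]
    by measurable
  have "((\<lambda>p. \<integral>\<rho>. indicator {- (p ^ 3)..} \<rho> *\<^sub>R saddle_integrand k p \<rho> \<partial>lborel) \<longlongrightarrow> (\<integral>\<rho>. ?g \<rho> \<partial>lborel)) at_top"
  proof (rule integral_dominated_convergence_at_top)
    show "?g \<in> borel_measurable lborel" by measurable
    show "(\<lambda>\<rho>. indicator {- (p ^ 3)..} \<rho> *\<^sub>R saddle_integrand k p \<rho>) \<in> borel_measurable lborel" for p
      by measurable
    have "?w = (\<lambda>\<rho>. exp (3 * (real k)\<^sup>2) * sqrt (2 * pi) * normal_density 0 1 \<rho>)"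
      by (simp add: normal_density_def fun_eq_iff diff_conv_add_uminus exp_add del: add_uminus_conv_diff)
    then show "integrable lborel ?w" by simp
    show "AE \<rho> in lborel. ((\<lambda>p. indicator {- (p ^ 3)..} \<rho> *\<^sub>R saddle_integrand k p \<rho>) \<longlongrightarrow> ?g \<rho>) at_top"
    proof (rule AE_I2)
      fix \<rho> :: real
      have "((\<lambda>p. saddle_integrand k p \<rho>) \<longlongrightarrow> (1 + (1 + \<i>) * of_real 0) ^ k *
          exp (- 2 * of_real (\<rho>\<^sup>2) - (2 + 2 * \<i>) * of_real 0)) at_top"
        unfolding saddle_integrand_def by (intro tendsto_intros) real_asymp+
      moreover have "\<forall>\<^sub>F p in at_top. - (p ^ 3) \<le> \<rho>" by real_asymp
      then have "\<forall>\<^sub>F p in at_top. saddle_integrand k p \<rho> = indicator {- (p ^ 3)..} \<rho> *\<^sub>R saddle_integrand k p \<rho>"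
        by eventually_elim simp
      ultimately show "((\<lambda>p. indicator {- (p ^ 3)..} \<rho> *\<^sub>R saddle_integrand k p \<rho>) \<longlongrightarrow> ?g \<rho>) at_top"
        using Lim_transform_eventually by fastforce
    qed
    show "\<forall>\<^sub>F p in at_top. AE \<rho> in lborel. norm (indicator {- (p ^ 3)..} \<rho> *\<^sub>R saddle_integrand k p \<rho>) \<le> ?w \<rho>"
      using eventually_ge_at_top[of 1]
    proof eventually_elim
      case (elim p)
      then show ?case using norm_saddle_integrand_le[of p _ k] by (auto simp: indicator_def)
    qed
  qed
  then show ?thesis
    unfolding has_bochner_integral_integral_eq[OF has_bochner_integral_exp_neg_2_sq]
    by (simp add: saddle_integral_def[abs_def] set_lebesgue_integral_def)
qed

text \<open>The amplitude \<open>u\<close> keeps rotating, so the squares themselves need not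
  converge. Only the error made by replacing \<open>K\<close> with its limit tends to 0, as the
  difference of squares factors into a vanishing and a bounded term.\<close>

lemma Re_sq_diff_tendsto_0:
  fixes u K :: "'a \<Rightarrow> complex"
  assumes K: "(K \<longlongrightarrow> of_real \<kappa>) F" and u: "\<And>p. norm (u p) \<le> B"
  shows "((\<lambda>p. (Re (u p * K p))\<^sup>2 - (Re (u p))\<^sup>2 * \<kappa>\<^sup>2) \<longlongrightarrow> 0) F"
proof (rule Lim_null_comparison)
  have "norm ((Re (u p * K p))\<^sup>2 - (Re (u p))\<^sup>2 * \<kappa>\<^sup>2) \<le> B * norm (K p - of_real \<kappa>) * (B * norm (K p + of_real \<kappa>))" for p
  proof -
    have "(Re (u p * K p))\<^sup>2 - (Re (u p))\<^sup>2 * \<kappa>\<^sup>2 = Re (u p * (K p - of_real \<kappa>)) * Re (u p * (K p + of_real \<kappa>))"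
      by (simp add: power2_eq_square algebra_simps)
    moreover have *: "\<bar>Re (u p * z)\<bar> \<le> B * norm z" for z
      using abs_Re_le_cmod[of "u p * z"] mult_right_mono[OF u, of "norm z" p] by (simp add: norm_mult)
    ultimately show ?thesis
      using mult_mono[OF * * order_trans[OF abs_ge_zero *] abs_ge_zero]
      by (simp only: real_norm_def abs_mult)
  qed
  then show "\<forall>\<^sub>F p in F. norm ((Re (u p * K p))\<^sup>2 - (Re (u p))\<^sup>2 * \<kappa>\<^sup>2) \<le>
      B * norm (K p - of_real \<kappa>) * (B * norm (K p + of_real \<kappa>))" by simp
  have "((\<lambda>p. B * norm (K p - of_real \<kappa>) * (B * norm (K p + of_real \<kappa>))) \<longlongrightarrow>
      B * norm (complex_of_real \<kappa> - of_real \<kappa>) * (B * norm (of_real \<kappa> + complex_of_real \<kappa>))) F"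
    by (intro tendsto_intros K)
  then show "((\<lambda>p. B * norm (K p - of_real \<kappa>) * (B * norm (K p + of_real \<kappa>))) \<longlongrightarrow> 0) F" by simp
qed

text \<open>Here \<open>Airy_Ai\<close> is close to \<open>Re (u p) * \<kappa> / (p * pi)\<close>
  and its derivative to \<open>p * Re (\<i> * u p) * \<kappa> / pi\<close>. Both summands of the
  energy then have order \<open>p\<^sup>2\<close>, and the squares of the two real parts add up to
  \<open>(norm (u p))\<^sup>2 = 2\<close>. The limit is
  \<open>2 * \<kappa>\<^sup>2 / pi\<^sup>2 = 1 / pi\<close>.\<close>

lemma airy_energy_saddle_tendsto: "((\<lambda>p. airy_energy (- (p ^ 4)) / p\<^sup>2) \<longlongrightarrow> 1 / pi) at_top"
proof -
  define u where "u p = (1 + \<i>) * exp (- (2 * \<i> * of_real (p ^ 6) / 3))" for p :: real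
  define \<kappa> where "\<kappa> = sqrt (pi / 2)"
  have nu: "norm (u p) = sqrt 2" for p
    by (simp add: u_def norm_mult norm_exp_eq_Re) (simp add: cmod_def)
  have "sqrt 2 \<le> 2" by (simp add: real_sqrt_le_iff')
  then have nu2: "norm (u p) \<le> 2" "norm (\<i> * u p) \<le> 2" for p
    by (simp_all add: nu norm_mult)
  have lims: "((\<lambda>p. (Re (\<i> * u p * saddle_integral 1 p))\<^sup>2 - (Re (\<i> * u p))\<^sup>2 * \<kappa>\<^sup>2) \<longlongrightarrow> 0) at_top"
    "((\<lambda>p. (Re (u p * saddle_integral 0 p))\<^sup>2 - (Re (u p))\<^sup>2 * \<kappa>\<^sup>2) \<longlongrightarrow> 0) at_top"
    unfolding \<kappa>_def
    by (rule Re_sq_diff_tendsto_0[OF saddle_integral_tendsto nu2(2)]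
        Re_sq_diff_tendsto_0[OF saddle_integral_tendsto nu2(1)])+
  \<comment> \<open>The summand \<open>pi\<close> restores the two subtracted oscillating terms,
    whose sum is constant in \<open>p\<close>.\<close>
  have "((\<lambda>p. ((Re (\<i> * u p * saddle_integral 1 p))\<^sup>2 - (Re (\<i> * u p))\<^sup>2 * \<kappa>\<^sup>2
       + ((Re (u p * saddle_integral 0 p))\<^sup>2 - (Re (u p))\<^sup>2 * \<kappa>\<^sup>2) + pi) / pi\<^sup>2) \<longlongrightarrow> (0 + 0 + pi) / pi\<^sup>2) at_top"
    by (intro tendsto_divide tendsto_add lims tendsto_const) simp
  moreover have "\<forall>\<^sub>F p in at_top. ((Re (\<i> * u p * saddle_integral 1 p))\<^sup>2 - (Re (\<i> * u p))\<^sup>2 * \<kappa>\<^sup>2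
       + ((Re (u p * saddle_integral 0 p))\<^sup>2 - (Re (u p))\<^sup>2 * \<kappa>\<^sup>2) + pi) / pi\<^sup>2 = airy_energy (- (p ^ 4)) / p\<^sup>2"
    using eventually_gt_at_top[of 0]
  proof eventually_elim
    case (elim p)
    have "(Re (u p))\<^sup>2 + (Im (u p))\<^sup>2 = 2"
      using nu[of p] by (simp add: cmod_def)
    then have "((Re (\<i> * u p))\<^sup>2 + (Re (u p))\<^sup>2) * \<kappa>\<^sup>2 = pi"
      by (simp add: \<kappa>_def add.commute)
    then have *: "(Re (\<i> * u p))\<^sup>2 * \<kappa>\<^sup>2 + (Re (u p))\<^sup>2 * \<kappa>\<^sup>2 = pi" by (simp add: algebra_simps)
    have "(1 + \<i>) * airy_moment 0 (- (p\<^sup>2)) (- (p ^ 4)) = (1 / p) *\<^sub>R (u p * saddle_integral 0 p)"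
      using airy_moment_saddle[OF elim, of 0] by (simp add: u_def mult_ac scaleR_conv_of_real)
    then have "Airy_Ai (- (p ^ 4)) = 1 / p * Re (u p * saddle_integral 0 p) / pi"
      unfolding Airy_Ai_eq_moment[of _ "- (p\<^sup>2)"] by (simp only: scaleR_complex.sel)
    moreover have "(1 + \<i>) * \<i> * airy_moment 1 (- (p\<^sup>2)) (- (p ^ 4)) = p *\<^sub>R (\<i> * u p * saddle_integral 1 p)"
      using airy_moment_saddle[OF elim, of 1] elim by (simp add: u_def mult_ac power2_eq_square scaleR_conv_of_real)
    then have "deriv Airy_Ai (- (p ^ 4)) = p * Re (\<i> * u p * saddle_integral 1 p) / pi"
      unfolding deriv_Airy_Ai_eq_moment[of _ "- (p\<^sup>2)"] by (simp only: scaleR_complex.sel)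
    ultimately have "airy_energy (- (p ^ 4)) / p\<^sup>2 =
        ((p * Re (\<i> * u p * saddle_integral 1 p) / pi)\<^sup>2
          + p ^ 4 * (1 / p * Re (u p * saddle_integral 0 p) / pi)\<^sup>2) / p\<^sup>2"
      unfolding airy_energy_def by (simp only: minus_mult_left[symmetric] diff_minus_eq_add)
    also have "\<dots> = ((Re (\<i> * u p * saddle_integral 1 p))\<^sup>2 + (Re (u p * saddle_integral 0 p))\<^sup>2) / pi\<^sup>2"
    proof -
      have "((p * b / pi)\<^sup>2 + p ^ 4 * (1 / p * a / pi)\<^sup>2) / p\<^sup>2 = (b\<^sup>2 + a\<^sup>2) / pi\<^sup>2" for a b
        using elim by (simp add: field_simps eval_nat_numeral)
      then show ?thesis .
    qed
    finally have "airy_energy (- (p ^ 4)) / p\<^sup>2 =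
        ((Re (\<i> * u p * saddle_integral 1 p))\<^sup>2 + (Re (u p * saddle_integral 0 p))\<^sup>2) / pi\<^sup>2" .
    with * show ?case by (simp del: times_complex.sel)
  qed
  ultimately have "((\<lambda>p. airy_energy (- (p ^ 4)) / p\<^sup>2) \<longlongrightarrow> (0 + 0 + pi) / pi\<^sup>2) at_top"
    by (rule Lim_transform_eventually)
  then show ?thesis by (simp add: power2_eq_square)
qed

lemma airy_energy_asymptotics: "((\<lambda>y. airy_energy (- y) / sqrt y) \<longlongrightarrow> 1 / pi) at_top"
proof -
  have "filterlim (\<lambda>y::real. sqrt (sqrt y)) at_top at_top"
    by (intro filterlim_compose[OF sqrt_at_top] sqrt_at_top)
  from filterlim_compose[OF airy_energy_saddle_tendsto this]
  have "((\<lambda>y. airy_energy (- (sqrt (sqrt y) ^ 4)) / (sqrt (sqrt y))\<^sup>2) \<longlongrightarrow> 1 / pi) at_top" .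
  moreover have "\<forall>\<^sub>F y in at_top. airy_energy (- (sqrt (sqrt y) ^ 4)) / (sqrt (sqrt y))\<^sup>2 = airy_energy (- y) / sqrt y"
    using eventually_ge_at_top[of 0]
  proof eventually_elim
    case (elim y)
    have "sqrt (sqrt y) ^ 4 = ((sqrt (sqrt y))\<^sup>2)\<^sup>2" by (simp flip: power_mult)
    also have "\<dots> = y" using elim by simp
    finally show ?case using elim by simp
  qed
  ultimately show ?thesis by (rule Lim_transform_eventually)
qed

section \<open>The deformed Airy function\<close>

lemma isCont_Airy [continuous_intros]:
  "isCont Airy_Ai x" "isCont airy_energy x"
  using Airy_Ai_has_derivative airy_energy_has_derivative by (blast intro: DERIV_isCont)+

lemma continuous_on_Airy [continuous_intros]:
  "continuous_on S f \<Longrightarrow> continuous_on S (\<lambda>x. Airy_Ai (f x))"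
  "continuous_on S f \<Longrightarrow> continuous_on S (\<lambda>x. airy_energy (f x))"
  by (rule continuous_on_compose2[of UNIV]; auto intro!: continuous_at_imp_continuous_on continuous_intros)+

text \<open>The dominated convergence below runs over arguments from near 0 down to minus infinity,
  so the asymptotics are not enough. Beyond \<open>N\<close> the quotient by the root is below 1
  because 1 exceeds \<open>1 / pi\<close>; compactness and the decay on the right cover the
  remaining arguments and cause the additive constant.\<close>

lemma airy_energy_bound:
  obtains C where "C > 0" "\<And>x. \<bar>airy_energy x\<bar> \<le> C * (1 + sqrt \<bar>x\<bar>)"
proof -
  have "1 / pi < 1" using pi_gt3 by simp
  moreover have "-1 < 1 / pi" by (rule less_trans[of _ 0]) auto
  ultimately have "\<forall>\<^sub>F y in at_top. - 1 < airy_energy (- y) / sqrt y \<and> airy_energy (- y) / sqrt y < 1"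
    using airy_energy_asymptotics by (intro eventually_conj order_tendstoD)
  then obtain N where N: "\<And>y. y \<ge> N \<Longrightarrow> - 1 < airy_energy (- y) / sqrt y \<and> airy_energy (- y) / sqrt y < 1"
    by (auto simp: eventually_at_top_linorder)
  obtain C1 where C1: "C1 > 0" "\<And>x. x \<ge> 0 \<Longrightarrow> \<bar>airy_energy x\<bar> \<le> C1 * exp (- x)"
    using airy_energy_decay by blast
  have "bounded (airy_energy ` {- \<bar>N\<bar>..0})"
    by (intro compact_imp_bounded compact_continuous_image continuous_intros compact_Icc)
  then obtain C2 where C2: "C2 > 0" "\<And>x. x \<in> {- \<bar>N\<bar>..0} \<Longrightarrow> \<bar>airy_energy x\<bar> \<le> C2"
    by (auto simp: bounded_pos)
  have "\<bar>airy_energy x\<bar> \<le> (C1 + C2 + 1) * (1 + sqrt \<bar>x\<bar>)" for x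
  proof -
    have s: "0 \<le> sqrt \<bar>x\<bar>" "0 \<le> (C1 + C2) * sqrt \<bar>x\<bar>" using C1 C2 by simp_all
    consider "x \<ge> 0" | "x \<in> {- \<bar>N\<bar>..0}" | "x < - \<bar>N\<bar>" by force
    then have "\<bar>airy_energy x\<bar> \<le> C1 + C2 + sqrt \<bar>x\<bar>"
    proof cases
      case 1
      then have "C1 * exp (- x) \<le> C1 * 1" using C1(1) by (intro mult_left_mono) auto
      with C1(2)[OF 1] C2(1) s(1) show ?thesis by linarith
    next
      case 2
      with C2(2)[OF 2] C1(1) s(1) show ?thesis by linarith
    next
      case 3
      then have "- x \<ge> N" "0 < sqrt (- x)" by auto
      with N[of "- x"] have "\<bar>airy_energy x\<bar> \<le> sqrt \<bar>x\<bar>"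
        using 3 by (simp add: field_simps abs_le_iff)
      with C1(1) C2(1) show ?thesis by linarith
    qed
    also have "\<dots> \<le> (C1 + C2 + 1) * (1 + sqrt \<bar>x\<bar>)"
      using s by (simp add: algebra_simps)
    finally show ?thesis .
  qed
  with that[of "C1 + C2 + 1"] C1 C2 show ?thesis by simp
qed

lemma deriv_deformed_Ai:
  "deriv (deformed_Ai b) \<zeta> = exp (b\<^sup>2 * \<zeta> / 2 + b ^ 6 / 12) *
     (b\<^sup>2 / 2 * Airy_Ai (\<zeta> + b ^ 4 / 4) + deriv Airy_Ai (\<zeta> + b ^ 4 / 4))"
  unfolding deformed_Ai_def[abs_def]
  by (rule DERIV_imp_deriv)
     (rule derivative_eq_intros DERIV_chain2[OF Airy_Ai_has_derivative] refl | simp add: algebra_simps)+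

lemma deriv_deriv_deformed_Ai:
  "deriv (deriv (deformed_Ai b)) \<zeta> = exp (b\<^sup>2 * \<zeta> / 2 + b ^ 6 / 12) *
     ((b ^ 4 / 4 + (\<zeta> + b ^ 4 / 4)) * Airy_Ai (\<zeta> + b ^ 4 / 4) + b\<^sup>2 * deriv Airy_Ai (\<zeta> + b ^ 4 / 4))"
  unfolding deriv_deformed_Ai[abs_def]
  by (rule DERIV_imp_deriv)
     (rule derivative_eq_intros DERIV_chain2[OF Airy_Ai_has_derivative]
        DERIV_chain2[OF deriv_Airy_Ai_has_derivative] refl
      | simp add: algebra_simps power2_eq_square power4_eq_xxxx)+

lemma exp_deformed_sq: "(exp (b\<^sup>2 * \<zeta> / 2 + b ^ 6 / 12))\<^sup>2 = exp (b ^ 6 / 6) * exp (b\<^sup>2 * \<zeta>)"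
  for b \<zeta> :: real
  by (simp add: power2_eq_square algebra_simps flip: exp_add)

lemma deformed_Ai_sq:
  "(deformed_Ai b \<zeta>)\<^sup>2 = exp (b ^ 6 / 6) * (exp (b\<^sup>2 * \<zeta>) * (Airy_Ai (\<zeta> + b ^ 4 / 4))\<^sup>2)"
  by (simp only: deformed_Ai_def power_mult_distrib exp_deformed_sq mult.assoc)

lemma deformed_Ai_mult_deriv:
  "deformed_Ai b \<zeta> * deriv (deformed_Ai b) \<zeta> = exp (b ^ 6 / 6) * (exp (b\<^sup>2 * \<zeta>) *
     (b\<^sup>2 / 2 * (Airy_Ai (\<zeta> + b ^ 4 / 4))\<^sup>2 + Airy_Ai (\<zeta> + b ^ 4 / 4) * deriv Airy_Ai (\<zeta> + b ^ 4 / 4)))"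
proof -
  have "x * u * (x * (c * u + v)) = x\<^sup>2 * (c * u\<^sup>2 + u * v)" for x u v c :: real
    by (simp add: power2_eq_square algebra_simps)
  then show ?thesis
    unfolding deriv_deformed_Ai deformed_Ai_def by (simp only: exp_deformed_sq mult.assoc)
qed

text \<open>Formally f'^2 - f f'' is - f^2 (ln f)''. An exponential factor with linear exponent
  drops out of the second logarithmic derivative and contributes only its square. The Airy equation
  turns what is left into the energy.\<close>

lemma deformed_Ai_energy:
  "(deriv (deformed_Ai b) p)\<^sup>2 - deformed_Ai b p * deriv (deriv (deformed_Ai b)) p =
     exp (b ^ 6 / 6) * (exp (b\<^sup>2 * p) * airy_energy (p + b ^ 4 / 4))"
proof -
  have "(x * (b\<^sup>2 / 2 * u + v))\<^sup>2 - x * u * (x * ((b ^ 4 / 4 + q) * u + b\<^sup>2 * v)) = x\<^sup>2 * (v\<^sup>2 - q * u\<^sup>2)"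
    for x u v q :: real
    by (simp add: power2_eq_square power4_eq_xxxx algebra_simps)
  then show ?thesis
    unfolding deriv_deriv_deformed_Ai deriv_deformed_Ai
    unfolding deformed_Ai_def airy_energy_def by (simp only: exp_deformed_sq mult.assoc)
qed

section \<open>Tail integrals of the weighted energy\<close>

definition energy_tail :: "real \<Rightarrow> real \<Rightarrow> real" where
  "energy_tail b \<zeta> = integral {\<zeta>..} (\<lambda>p. exp (b\<^sup>2 * p) * airy_energy (p + b ^ 4 / 4))"

text \<open>The weight grows at rate \<open>b\<^sup>2\<close> against the decay of the energy at
  rate 1. The bound 1/2 on \<open>b\<^sup>2\<close> leaves half of the decay, uniformly in
  \<open>b\<close>; it holds eventually, since the limit takes \<open>b\<close> to 0.\<close>

lemma weighted_energy_bound: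
  obtains C where "C > 0" "\<And>b p. b\<^sup>2 \<le> 1 / 2 \<Longrightarrow> p \<ge> 0 \<Longrightarrow>
    \<bar>exp (b\<^sup>2 * p) * airy_energy (p + b ^ 4 / 4)\<bar> \<le> C * exp (- (1 / 2) * p)"
proof -
  obtain C where C: "C > 0" "\<And>x. x \<ge> 0 \<Longrightarrow> \<bar>airy_energy x\<bar> \<le> C * exp (- x)"
    using airy_energy_decay by blast
  have "\<bar>exp (b\<^sup>2 * p) * airy_energy (p + b ^ 4 / 4)\<bar> \<le> C * exp (- (1 / 2) * p)"
    if b: "b\<^sup>2 \<le> 1 / 2" and p: "p \<ge> 0" for b p :: real
  proof -
    have q: "p + b ^ 4 / 4 \<ge> 0" using p by simp
    have "\<bar>exp (b\<^sup>2 * p) * airy_energy (p + b ^ 4 / 4)\<bar> \<le> exp (b\<^sup>2 * p) * (C * exp (- (p + b ^ 4 / 4)))"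
      using C(2)[OF q] by (simp add: abs_mult)
    also have "\<dots> = C * exp (b\<^sup>2 * p - p - b ^ 4 / 4)" unfolding mult.left_commute[of _ C] by (simp flip: exp_add)
    also have "\<dots> \<le> C * exp (- (1 / 2) * p)"
    proof -
      have "0 \<le> b ^ 4" by simp
      then have "b\<^sup>2 * p - p - b ^ 4 / 4 \<le> - (1 / 2) * p"
        using mult_right_mono[OF b p] by linarith
      then show ?thesis using C(1) by simp
    qed
    finally show ?thesis .
  qed
  with that C(1) show ?thesis by blast
qed

text \<open>The bound does not depend on \<open>b\<close>, so the part of the tail on the positive
  axis disappears after division by \<open>\<nu> ^ 3\<close>.\<close>

lemma weighted_energy_tail_bound:
  obtains C where "C > 0" "\<And>b. b\<^sup>2 \<le> 1 / 2 \<Longrightarrow>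
    (\<lambda>p. exp (b\<^sup>2 * p) * airy_energy (p + b ^ 4 / 4)) integrable_on {0..}"
    "\<And>b. b\<^sup>2 \<le> 1 / 2 \<Longrightarrow> \<bar>energy_tail b 0\<bar> \<le> C"
proof -
  obtain C where C: "C > 0" "\<And>b p. b\<^sup>2 \<le> 1 / 2 \<Longrightarrow> p \<ge> 0 \<Longrightarrow>
    \<bar>exp (b\<^sup>2 * p) * airy_energy (p + b ^ 4 / 4)\<bar> \<le> C * exp (- (1 / 2) * p)"
    using weighted_energy_bound by blast
  have e: "((\<lambda>p::real. C * exp (- (1 / 2) * p)) has_integral C * (exp (- (1 / 2) * 0) / (1 / 2))) {0..}"
    by (intro has_integral_mult_right has_integral_exp_minus_to_infinity) simp
  have int: "(\<lambda>p. exp (b\<^sup>2 * p) * airy_energy (p + b ^ 4 / 4)) integrable_on {0..}" if b: "b\<^sup>2 \<le> 1 / 2" for b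
  proof (rule measurable_bounded_by_integrable_imp_integrable)
    show "(\<lambda>p. exp (b\<^sup>2 * p) * airy_energy (p + b ^ 4 / 4)) \<in> borel_measurable (lebesgue_on {0..})"
      by (intro continuous_imp_measurable_on_sets_lebesgue continuous_intros) auto
    show "(\<lambda>p. C * exp (- (1 / 2) * p)) integrable_on {0..}" using e by blast
  qed (use C(2)[OF b] in auto)
  have "\<bar>energy_tail b 0\<bar> \<le> 2 * C" if b: "b\<^sup>2 \<le> 1 / 2" for b
  proof -
    have "norm (energy_tail b 0) \<le> integral {0..} (\<lambda>p. C * exp (- (1 / 2) * p))"
      unfolding energy_tail_def using e C(2)[OF b]
      by (intro integral_norm_bound_integral int b) auto
    also have "\<dots> = 2 * C" unfolding integral_unique[OF e] by simp
    finally show ?thesis by simp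
  qed
  with that[of "2 * C"] C(1) int show ?thesis by auto
qed

lemma energy_tail_split:
  assumes b: "b\<^sup>2 \<le> 1 / 2" and "\<zeta> \<le> 0"
  shows "((\<lambda>p. exp (b\<^sup>2 * p) * airy_energy (p + b ^ 4 / 4)) has_integral
      integral {\<zeta>..0} (\<lambda>p. exp (b\<^sup>2 * p) * airy_energy (p + b ^ 4 / 4)) + energy_tail b 0) {\<zeta>..}"
proof -
  let ?G = "\<lambda>p. exp (b\<^sup>2 * p) * airy_energy (p + b ^ 4 / 4)"
  have "(?G has_integral integral {\<zeta>..0} ?G + energy_tail b 0) ({\<zeta>..0} \<union> {0..})"
  proof (rule has_integral_Un)
    show "(?G has_integral integral {\<zeta>..0} ?G) {\<zeta>..0}"
      by (intro integrable_integral integrable_continuous_real continuous_intros)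
    show "(?G has_integral energy_tail b 0) {0..}"
    proof -
      have "?G integrable_on {0..}"
        by (rule weighted_energy_tail_bound) (use b in blast)
      then show ?thesis unfolding energy_tail_def by (rule integrable_integral)
    qed
    have "{\<zeta>..0} \<inter> {0..} = {0}" using \<open>\<zeta> \<le> 0\<close> by auto
    then show "negligible ({\<zeta>..0} \<inter> {0..})" by simp
  qed
  moreover have "{\<zeta>..0} \<union> {0..} = {\<zeta>..}" using \<open>\<zeta> \<le> 0\<close> by auto
  ultimately show ?thesis by simp
qed

lemma energy_tail_eq:
  assumes "b\<^sup>2 \<le> 1 / 2" and "\<zeta> \<le> 0"
  shows "energy_tail b \<zeta> =
    integral {\<zeta>..0} (\<lambda>p. exp (b\<^sup>2 * p) * airy_energy (p + b ^ 4 / 4)) + energy_tail b 0"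
    "((\<lambda>p. exp (b\<^sup>2 * p) * airy_energy (p + b ^ 4 / 4)) has_integral energy_tail b \<zeta>) {\<zeta>..}"
proof -
  show *: "energy_tail b \<zeta> =
    integral {\<zeta>..0} (\<lambda>p. exp (b\<^sup>2 * p) * airy_energy (p + b ^ 4 / 4)) + energy_tail b 0"
    unfolding energy_tail_def[of b \<zeta>] by (rule integral_unique[OF energy_tail_split[OF assms]])
  show "((\<lambda>p. exp (b\<^sup>2 * p) * airy_energy (p + b ^ 4 / 4)) has_integral energy_tail b \<zeta>) {\<zeta>..}"
    unfolding * by (rule energy_tail_split[OF assms])
qed

lemma T3_eq: "T3 b \<zeta> = exp (b ^ 6 / 6) * energy_tail b \<zeta>"
  unfolding T3_def energy_tail_def deformed_Ai_energy by simp

lemma integral_deformed_Ai_sq: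
  assumes b: "b\<^sup>2 \<le> 1 / 2" and \<zeta>: "\<zeta> \<le> 0"
  shows "integral {\<zeta>..} (\<lambda>p. (deformed_Ai b p)\<^sup>2) =
    exp (b ^ 6 / 6) * (exp (b\<^sup>2 * \<zeta>) * airy_energy (\<zeta> + b ^ 4 / 4) + b\<^sup>2 * energy_tail b \<zeta>)"
proof -
  let ?H = "\<lambda>p. exp (b\<^sup>2 * p) * airy_energy (p + b ^ 4 / 4)"
  let ?W = "\<lambda>p. exp (b\<^sup>2 * p) * (Airy_Ai (p + b ^ 4 / 4))\<^sup>2"
  \<comment> \<open>The derivative contains the wanted integrand \<open>?W\<close> and a multiple of
    \<open>?H\<close>, whose integral is the energy tail.\<close>
  have dH: "(?H has_real_derivative b\<^sup>2 * ?H p - ?W p) (at p)" for p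
    by (rule derivative_eq_intros DERIV_chain2[OF airy_energy_has_derivative] refl | simp add: algebra_simps)+
  have "((\<lambda>p. b\<^sup>2 * ?H p - ?W p) has_integral 0 - ?H \<zeta>) {\<zeta>..}"
  proof (rule has_integral_improper)
    show "(\<lambda>p. b\<^sup>2 * ?H p - ?W p) integrable_on {\<zeta>..R}" for R
      by (intro integrable_continuous_real continuous_intros)
    have "\<forall>\<^sub>F R in at_top. ?H R - ?H \<zeta> = integral {\<zeta>..R} (\<lambda>p. b\<^sup>2 * ?H p - ?W p)"
      using eventually_ge_at_top[of \<zeta>]
    proof eventually_elim
      case (elim R)
      then have "((\<lambda>p. b\<^sup>2 * ?H p - ?W p) has_integral ?H R - ?H \<zeta>) {\<zeta>..R}"
        using dH by (intro fundamental_theorem_of_calculus)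
          (auto simp: has_real_derivative_iff_has_vector_derivative intro: has_vector_derivative_at_within)
      then show ?case by (simp add: integral_unique)
    qed
    moreover have "((\<lambda>R. ?H R - ?H \<zeta>) \<longlongrightarrow> 0 - ?H \<zeta>) at_top"
    proof (intro tendsto_diff tendsto_const)
      obtain C where C: "C > 0" "\<And>b p. b\<^sup>2 \<le> 1 / 2 \<Longrightarrow> p \<ge> 0 \<Longrightarrow>
        \<bar>exp (b\<^sup>2 * p) * airy_energy (p + b ^ 4 / 4)\<bar> \<le> C * exp (- (1 / 2) * p)"
        using weighted_energy_bound by blast
      show "(?H \<longlongrightarrow> 0) at_top"
      proof (rule Lim_null_comparison)
        show "\<forall>\<^sub>F p in at_top. norm (?H p) \<le> C * exp (- (1 / 2) * p)"
          using eventually_ge_at_top[of 0] by eventually_elim (use C(2)[OF b] in simp)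
        have "((\<lambda>p::real. exp (- (1 / 2) * p)) \<longlongrightarrow> 0) at_top" by real_asymp
        then show "((\<lambda>p. C * exp (- (1 / 2) * p)) \<longlongrightarrow> 0) at_top" by (rule tendsto_mult_right_zero)
      qed
    qed
    ultimately show "((\<lambda>R. integral {\<zeta>..R} (\<lambda>p. b\<^sup>2 * ?H p - ?W p)) \<longlongrightarrow> 0 - ?H \<zeta>) at_top"
      by (rule Lim_transform_eventually[rotated])
  qed
  \<comment> \<open>Integrability of \<open>?W\<close> is a by-product: it is a difference of two
    functions already known to be integrable.\<close>
  from has_integral_diff[OF has_integral_mult_right[OF energy_tail_eq(2)[OF b \<zeta>], of "b\<^sup>2"] this]
  have "(?W has_integral ?H \<zeta> + b\<^sup>2 * energy_tail b \<zeta>) {\<zeta>..}" by (simp add: add.commute)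
  from has_integral_mult_right[OF this, of "exp (b ^ 6 / 6)"]
  show ?thesis unfolding deformed_Ai_sq by (rule integral_unique)
qed

section \<open>The limit\<close>

text \<open>For \<open>s > 0\<close> the argument of the energy tends to minus infinity like
  \<open>- Y * s\<^sup>2\<close>, so the quotient by \<open>sqrt Y\<close> tends to
  \<open>s / pi\<close>. The shift \<open>\<delta>\<close> stands for the small term
  \<open>b ^ 4 / 4\<close> in the deformed Airy function.\<close>

lemma weighted_energy_tendsto:
  fixes Y \<delta> :: "real \<Rightarrow> real"
  assumes Y: "filterlim Y at_top at_top" and \<delta>: "(\<delta> \<longlongrightarrow> 0) at_top" and c: "c > 0"
  shows "((\<lambda>\<nu>. integral {0..1} (\<lambda>s. 2 * s * exp (- (c * s\<^sup>2)) * (airy_energy (\<delta> \<nu> - Y \<nu> * s\<^sup>2) / sqrt (Y \<nu>))))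
    \<longlongrightarrow> integral {0..1} (\<lambda>s. 2 * s * exp (- (c * s\<^sup>2)) * (s / pi))) at_top"
proof -
  let ?f = "\<lambda>\<nu> s. 2 * s * exp (- (c * s\<^sup>2)) * (airy_energy (\<delta> \<nu> - Y \<nu> * s\<^sup>2) / sqrt (Y \<nu>))"
  let ?g = "\<lambda>s::real. 2 * s * exp (- (c * s\<^sup>2)) * (s / pi)"
  obtain C where C: "C > 0" "\<And>x. \<bar>airy_energy x\<bar> \<le> C * (1 + sqrt \<bar>x\<bar>)"
    using airy_energy_bound by blast
  have evY: "\<forall>\<^sub>F \<nu> in at_top. Y \<nu> \<ge> 1" using Y by (simp add: filterlim_at_top)
  have ev\<delta>: "\<forall>\<^sub>F \<nu> in at_top. \<bar>\<delta> \<nu>\<bar> < 1"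
    using tendstoD[OF \<delta>, of 1] by simp
  have cont_f: "continuous_on {0..1} (?f \<nu>)" for \<nu>
    unfolding divide_inverse by (intro continuous_intros)
  have cont_g: "continuous_on {0..1} ?g"
    by (intro continuous_intros) simp
  have "((\<lambda>\<nu>. LINT s:{0..1}|lborel. ?f \<nu> s) \<longlongrightarrow> (LINT s:{0..1}|lborel. ?g s)) at_top"
    unfolding set_lebesgue_integral_def
  proof (rule integral_dominated_convergence_at_top)
    show "(\<lambda>s. indicator {0..1} s *\<^sub>R ?g s) \<in> borel_measurable lborel"
      using borel_integrable_atLeastAtMost'[OF cont_g] by (simp add: set_integrable_def)
    show "(\<lambda>s. indicator {0..1} s *\<^sub>R ?f \<nu> s) \<in> borel_measurable lborel" for \<nu>
      using borel_integrable_atLeastAtMost'[OF cont_f] by (simp add: set_integrable_def)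
    \<comment> \<open>The argument of the energy is at most \<open>4 * Y\<close> in modulus, so its
      root is at most \<open>2 * sqrt Y\<close>. The additive 1 makes this
      \<open>3 * sqrt Y\<close>, and the weight \<open>2 * s\<close> doubles the constant 3.\<close>
    show "integrable lborel (\<lambda>s::real. indicator {0..1} s *\<^sub>R (6 * C))"
      unfolding set_integrable_def[symmetric] by (intro borel_integrable_atLeastAtMost' continuous_intros)
    show "\<forall>\<^sub>F \<nu> in at_top. AE s in lborel. norm (indicator {0..1} s *\<^sub>R ?f \<nu> s) \<le> indicator {0..1} s *\<^sub>R (6 * C)"
      using evY ev\<delta>
    proof eventually_elim
      case (elim \<nu>)
      have "\<bar>?f \<nu> s\<bar> \<le> 6 * C" if s: "0 \<le> s" "s \<le> 1" for s
      proof -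
        have "s\<^sup>2 \<le> 1" using s by (simp add: power_le_one)
        then have "Y \<nu> * s\<^sup>2 \<le> Y \<nu> * 1" using elim by (intro mult_left_mono) auto
        moreover have "0 \<le> Y \<nu> * s\<^sup>2" using elim by simp
        ultimately have "\<bar>\<delta> \<nu> - Y \<nu> * s\<^sup>2\<bar> \<le> 4 * Y \<nu>" using elim by linarith
        then have "sqrt \<bar>\<delta> \<nu> - Y \<nu> * s\<^sup>2\<bar> \<le> sqrt (4 * Y \<nu>)" by (rule real_sqrt_le_mono)
        also have "\<dots> = 2 * sqrt (Y \<nu>)" by (simp add: real_sqrt_mult)
        finally have r: "sqrt \<bar>\<delta> \<nu> - Y \<nu> * s\<^sup>2\<bar> \<le> 2 * sqrt (Y \<nu>)" .
        have sY: "1 \<le> sqrt (Y \<nu>)" using elim by simp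
        have "\<bar>airy_energy (\<delta> \<nu> - Y \<nu> * s\<^sup>2)\<bar> \<le> C * (1 + sqrt \<bar>\<delta> \<nu> - Y \<nu> * s\<^sup>2\<bar>)" by (rule C(2))
        also have "\<dots> \<le> C * (3 * sqrt (Y \<nu>))" using C(1) r sY by (intro mult_left_mono) linarith+
        finally have "\<bar>airy_energy (\<delta> \<nu> - Y \<nu> * s\<^sup>2) / sqrt (Y \<nu>)\<bar> \<le> 3 * C"
          using elim by (simp add: abs_divide divide_simps mult_ac)
        moreover have "\<bar>2 * s * exp (- (c * s\<^sup>2))\<bar> \<le> 2 * 1"
          using s c unfolding abs_mult by (intro mult_mono) auto
        ultimately have "\<bar>2 * s * exp (- (c * s\<^sup>2))\<bar> * \<bar>airy_energy (\<delta> \<nu> - Y \<nu> * s\<^sup>2) / sqrt (Y \<nu>)\<bar> \<le> 2 * 1 * (3 * C)"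
          by (intro mult_mono) auto
        then show ?thesis by (simp only: abs_mult)
      qed
      then show ?case by (auto simp: indicator_def)
    qed
    show "AE s in lborel. ((\<lambda>\<nu>. indicator {0..1} s *\<^sub>R ?f \<nu> s) \<longlongrightarrow> indicator {0..1} s *\<^sub>R ?g s) at_top"
    proof (rule AE_I2)
      fix s :: real
      have "((\<lambda>\<nu>. ?f \<nu> s) \<longlongrightarrow> ?g s) at_top" if s: "0 < s"
      proof -
        define y where "y \<nu> = Y \<nu> * s\<^sup>2 - \<delta> \<nu>" for \<nu>
        have "filterlim (\<lambda>\<nu>. - \<delta> \<nu> + s\<^sup>2 * Y \<nu>) at_top at_top"
          using s by (intro filterlim_tendsto_add_at_top[OF tendsto_minus[OF \<delta>]]
              filterlim_tendsto_pos_mult_at_top[OF tendsto_const] Y) simp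
        then have ytop: "filterlim y at_top at_top"
          by (simp add: y_def[abs_def] mult.commute)
        from filterlim_compose[OF airy_energy_asymptotics this]
        have 1: "((\<lambda>\<nu>. airy_energy (- y \<nu>) / sqrt (y \<nu>)) \<longlongrightarrow> 1 / pi) at_top" .
        have "((\<lambda>\<nu>. s\<^sup>2 - \<delta> \<nu> * inverse (Y \<nu>)) \<longlongrightarrow> s\<^sup>2 - 0 * 0) at_top"
          by (intro tendsto_intros \<delta> filterlim_compose[OF tendsto_inverse_0_at_top[OF filterlim_ident] Y])
        from tendsto_real_sqrt[OF this]
        have 2: "((\<lambda>\<nu>. sqrt (s\<^sup>2 - \<delta> \<nu> * inverse (Y \<nu>))) \<longlongrightarrow> s) at_top" using s by simp
        have "((\<lambda>\<nu>. (airy_energy (- y \<nu>) / sqrt (y \<nu>)) * sqrt (s\<^sup>2 - \<delta> \<nu> * inverse (Y \<nu>))) \<longlongrightarrow> 1 / pi * s) at_top"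
          by (intro tendsto_mult 1 2)
        moreover have "\<forall>\<^sub>F \<nu> in at_top. y \<nu> \<ge> 1" using ytop by (simp add: filterlim_at_top)
        with evY have "\<forall>\<^sub>F \<nu> in at_top. (airy_energy (- y \<nu>) / sqrt (y \<nu>)) * sqrt (s\<^sup>2 - \<delta> \<nu> * inverse (Y \<nu>))
            = airy_energy (\<delta> \<nu> - Y \<nu> * s\<^sup>2) / sqrt (Y \<nu>)"
        proof eventually_elim
          case (elim \<nu>)
          have "s\<^sup>2 - \<delta> \<nu> * inverse (Y \<nu>) = y \<nu> / Y \<nu>" using elim by (simp add: y_def field_simps)
          then show ?case using elim by (simp add: real_sqrt_divide) (simp add: y_def)
        qed
        ultimately have "((\<lambda>\<nu>. airy_energy (\<delta> \<nu> - Y \<nu> * s\<^sup>2) / sqrt (Y \<nu>)) \<longlongrightarrow> 1 / pi * s) at_top"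
          by (rule Lim_transform_eventually)
        from tendsto_mult[OF tendsto_const this, of "2 * s * exp (- (c * s\<^sup>2))"]
        show ?thesis by simp
      qed
      \<comment> \<open>At \<open>s = 0\<close> the argument does not go to minus infinity, but the
        weight \<open>2 * s\<close> vanishes.\<close>
      moreover have "((\<lambda>\<nu>. ?f \<nu> s) \<longlongrightarrow> ?g s) at_top" if "s = 0" using that by simp
      ultimately show "((\<lambda>\<nu>. indicator {0..1} s *\<^sub>R ?f \<nu> s) \<longlongrightarrow> indicator {0..1} s *\<^sub>R ?g s) at_top"
        by (cases "s \<in> {0..1}") (auto simp: le_less)
    qed
  qed
  moreover have "(LINT s:{0..1}|lborel. ?f \<nu> s) = integral {0..1} (?f \<nu>)" for \<nu>
    by (rule set_borel_integral_eq_integral(2)[OF borel_integrable_atLeastAtMost'[OF cont_f]])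
  moreover have "(LINT s:{0..1}|lborel. ?g s) = integral {0..1} ?g"
    by (rule set_borel_integral_eq_integral(2)[OF borel_integrable_atLeastAtMost'[OF cont_g]])
  ultimately show ?thesis by (simp only:)
qed

text \<open>Integration by parts: \<open>s * exp (- (c * s\<^sup>2))\<close> has derivative
  \<open>(1 - 2 * c * s\<^sup>2) * exp (- (c * s\<^sup>2))\<close>.\<close>

lemma integral_weighted_sq:
  assumes c: "c > 0"
  shows "integral {0..1} (\<lambda>s. 2 * s * exp (- (c * s\<^sup>2)) * (s / pi)) =
    (integral {0..1} (\<lambda>s. exp (- (c * s\<^sup>2))) - exp (- c)) / (c * pi)"
proof -
  have "((\<lambda>s. exp (- (c * s\<^sup>2)) - c * pi * (2 * s * exp (- (c * s\<^sup>2)) * (s / pi)))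
      has_integral 1 * exp (- (c * 1\<^sup>2)) - 0 * exp (- (c * 0\<^sup>2))) {0..1}"
    by (rule fundamental_theorem_of_calculus)
       (auto intro!: derivative_eq_intros has_vector_derivative_at_within
         simp: power2_eq_square field_simps simp flip: has_real_derivative_iff_has_vector_derivative)
  moreover have "((\<lambda>s. exp (- (c * s\<^sup>2))) has_integral integral {0..1} (\<lambda>s. exp (- (c * s\<^sup>2)))) {0..1}"
    by (intro integrable_integral integrable_continuous_real continuous_intros)
  ultimately have "((\<lambda>s. exp (- (c * s\<^sup>2)) - (exp (- (c * s\<^sup>2)) - c * pi * (2 * s * exp (- (c * s\<^sup>2)) * (s / pi))))
      has_integral integral {0..1} (\<lambda>s. exp (- (c * s\<^sup>2))) - (1 * exp (- (c * 1\<^sup>2)) - 0 * exp (- (c * 0\<^sup>2)))) {0..1}"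
    by (rule has_integral_diff[rotated])
  then have "((\<lambda>s. c * pi * (2 * s * exp (- (c * s\<^sup>2)) * (s / pi)))
      has_integral integral {0..1} (\<lambda>s. exp (- (c * s\<^sup>2))) - exp (- c)) {0..1}"
    by simp
  from has_integral_mult_right[OF this, of "1 / (c * pi)"]
  have "((\<lambda>s. 2 * s * exp (- (c * s\<^sup>2)) * (s / pi))
      has_integral (integral {0..1} (\<lambda>s. exp (- (c * s\<^sup>2))) - exp (- c)) / (c * pi)) {0..1}"
    using c by (simp add: field_simps)
  then show ?thesis by (rule integral_unique)
qed

text \<open>With \<open>s\<close> the square root of the relative depth, the square root growth of
  the energy becomes linear in \<open>s\<close> and the exponential weight becomes the Gaussian of
  the limit.\<close>

lemma integral_neg_substitution_square:
  fixes f :: "real \<Rightarrow> real"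
  assumes "Y > 0" and "continuous_on {- Y..0} f"
  shows "integral {- Y..0} f = Y * integral {0..1} (\<lambda>s. 2 * s * f (- (Y * s\<^sup>2)))"
proof -
  \<comment> \<open>The substitution reverses orientation: the first integral runs over an empty
    interval because \<open>Y > 0\<close>, and only the second one, with its minus sign, is
    left.\<close>
  have "((\<lambda>s. (- (Y * (2 * s))) *\<^sub>R f (- (Y * s\<^sup>2))) has_integral
      (integral {- (Y * 0\<^sup>2)..- (Y * 1\<^sup>2)} f - integral {- (Y * 1\<^sup>2)..- (Y * 0\<^sup>2)} f)) {0..1}"
  proof (rule has_integral_substitution_general[of "{}"])
    show "(\<lambda>s. - (Y * s\<^sup>2)) ` {0..1} \<subseteq> {- Y..0}"
      using assms(1) by (auto simp: power_le_one)
    show "((\<lambda>s. - (Y * s\<^sup>2)) has_real_derivative - (Y * (2 * s))) (at s within {0..1})" for s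
      by (auto intro!: derivative_eq_intros)
  qed (use assms in \<open>auto intro!: continuous_intros\<close>)
  from has_integral_mult_right[OF this, of "- (1 / Y)"]
  have "((\<lambda>s. 2 * s * f (- (Y * s\<^sup>2))) has_integral integral {- Y..0} f / Y) {0..1}"
    using assms(1) by (simp add: field_simps)
  then show ?thesis using assms(1) by (simp add: integral_unique)
qed

text \<open>Left of - 1 both summands of the energy are nonnegative and the weight
  \<open>- q\<close> is at least 1, so it dominates the sum of the two squares. This controls the
  oscillating boundary terms of \<open>T0\<close> and \<open>T1\<close> without asymptotics of their
  own.\<close>

lemma Airy_Ai_le_energy:
  assumes "q \<le> - 1"
  shows "(Airy_Ai q)\<^sup>2 \<le> airy_energy q" "\<bar>Airy_Ai q * deriv Airy_Ai q\<bar> \<le> airy_energy q"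
proof -
  have "1 * (Airy_Ai q)\<^sup>2 \<le> - q * (Airy_Ai q)\<^sup>2"
    using assms by (intro mult_right_mono) auto
  then have *: "(deriv Airy_Ai q)\<^sup>2 + (Airy_Ai q)\<^sup>2 \<le> airy_energy q"
    by (simp add: airy_energy_def)
  then show "(Airy_Ai q)\<^sup>2 \<le> airy_energy q"
    using zero_le_power2[of "deriv Airy_Ai q"] by linarith
  have "0 \<le> (\<bar>Airy_Ai q\<bar> - \<bar>deriv Airy_Ai q\<bar>)\<^sup>2" by simp
  then have "2 * \<bar>Airy_Ai q * deriv Airy_Ai q\<bar> \<le> (deriv Airy_Ai q)\<^sup>2 + (Airy_Ai q)\<^sup>2"
    by (simp add: power2_diff abs_mult)
  with * show "\<bar>Airy_Ai q * deriv Airy_Ai q\<bar> \<le> airy_energy q" by linarith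
qed

section \<open>Scaling limit of the density\<close>

theorem corollary2p4:
  fixes a w t A :: real
  assumes "a > 0" and "w > 0" and "t > 0" and "A = a\<^sup>2 * w"
  shows "((\<lambda>\<nu>::real. inverse \<nu> * P_we (a / (\<nu> * sqrt 2)) (- (\<nu>\<^sup>2 * w)) t) \<longlongrightarrow>
     A * sqrt w / (2 * pi * t\<^sup>2) * exp (- (A / (2 * t))) *
       ((2 / A - 1 / t) * exp (- (A / 2))
        + (1 + 1 / t - 2 / A) * integral {0..1} (\<lambda>s. exp (- (A * s\<^sup>2 / 2))))) at_top"
proof -
  define b where "b \<nu> = a / (\<nu> * sqrt 2)" for \<nu> :: real
  define Y where "Y \<nu> = \<nu>\<^sup>2 * w" for \<nu> :: real
  define \<delta> where "\<delta> \<nu> = b \<nu> ^ 4 / 4" for \<nu> :: real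
  define J where "J = integral {0..1} (\<lambda>s. exp (- (A * s\<^sup>2 / 2)))"
  \<comment> \<open>This is the limit of \<open>T3\<close> divided by \<open>\<nu> ^ 3\<close>. The
    factor \<open>w * sqrt w\<close> comes from
    \<open>Y * sqrt Y = \<nu> ^ 3 * (w * sqrt w)\<close>: one \<open>Y\<close> from the
    substitution, the root from the growth of the energy.\<close>
  define m where "m = w * sqrt w * ((J - exp (- (A / 2))) / (A / 2 * pi))"
  have A: "A > 0" using assms by simp
  have b2: "(b \<nu>)\<^sup>2 = a\<^sup>2 / (2 * \<nu>\<^sup>2)" for \<nu>
    by (simp add: b_def power_divide power_mult_distrib)
  have b0: "(b \<longlongrightarrow> 0) at_top"
    unfolding b_def[abs_def] using assms(1) by real_asymp
  have bpow: "((\<lambda>\<nu>. b \<nu> ^ Suc n) \<longlongrightarrow> 0) at_top" for n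
    using tendsto_power[OF b0, of "Suc n"] by simp
  have \<delta>0: "(\<delta> \<longlongrightarrow> 0) at_top"
    using tendsto_divide[OF bpow[of 3] tendsto_const[of 4]] by (simp add: \<delta>_def[abs_def] numeral_eq_Suc)
  have Ytop: "filterlim Y at_top at_top"
    unfolding Y_def[abs_def] using assms(2) by real_asymp
  have ev_b: "\<forall>\<^sub>F \<nu> in at_top. (b \<nu>)\<^sup>2 \<le> 1 / 2"
    using order_tendstoD(2)[OF bpow[of 1], of "1/2"] by (auto simp: numeral_2_eq_2 elim: eventually_mono)
  have ev_pos: "\<forall>\<^sub>F \<nu>::real in at_top. \<nu> > 0" by (rule eventually_gt_at_top)
  have bY: "(b \<nu>)\<^sup>2 * Y \<nu> = A / 2" if "\<nu> > 0" for \<nu>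
    using that by (simp add: b2 Y_def assms(4))

  have tail: "((\<lambda>\<nu>. energy_tail (b \<nu>) (- Y \<nu>) / \<nu> ^ 3) \<longlongrightarrow> m) at_top"
  proof -
    obtain C where C: "C > 0" "\<And>b. b\<^sup>2 \<le> 1 / 2 \<Longrightarrow> \<bar>energy_tail b 0\<bar> \<le> C"
      by (rule weighted_energy_tail_bound) (rule that; blast)
    have rest: "((\<lambda>\<nu>. energy_tail (b \<nu>) 0 / \<nu> ^ 3) \<longlongrightarrow> 0) at_top"
    proof (rule Lim_null_comparison)
      show "\<forall>\<^sub>F \<nu> in at_top. norm (energy_tail (b \<nu>) 0 / \<nu> ^ 3) \<le> C / \<nu> ^ 3"
        using ev_b ev_pos by eventually_elim (use C(2) in \<open>simp add: abs_divide divide_right_mono\<close>)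
      show "((\<lambda>\<nu>. C / \<nu> ^ 3) \<longlongrightarrow> 0) at_top" by real_asymp
    qed
    let ?I = "\<lambda>\<nu>. integral {0..1} (\<lambda>s. 2 * s * exp (- (A / 2 * s\<^sup>2)) * (airy_energy (\<delta> \<nu> - Y \<nu> * s\<^sup>2) / sqrt (Y \<nu>)))"
    have "(?I \<longlongrightarrow> (integral {0..1} (\<lambda>s. exp (- (A / 2 * s\<^sup>2))) - exp (- (A / 2))) / (A / 2 * pi)) at_top"
      using weighted_energy_tendsto[OF Ytop \<delta>0, of "A / 2"] integral_weighted_sq[of "A / 2"] A by simp
    then have "((\<lambda>\<nu>. w * sqrt w * ?I \<nu> + energy_tail (b \<nu>) 0 / \<nu> ^ 3) \<longlongrightarrow> m + 0) at_top"
      unfolding m_def J_def by (intro tendsto_add tendsto_mult tendsto_const rest) simp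
    moreover have "\<forall>\<^sub>F \<nu> in at_top. w * sqrt w * ?I \<nu> + energy_tail (b \<nu>) 0 / \<nu> ^ 3 = energy_tail (b \<nu>) (- Y \<nu>) / \<nu> ^ 3"
      using ev_b ev_pos
    proof eventually_elim
      case (elim \<nu>)
      have Y: "Y \<nu> > 0" using elim assms by (simp add: Y_def)
      let ?G = "\<lambda>p. exp ((b \<nu>)\<^sup>2 * p) * airy_energy (p + b \<nu> ^ 4 / 4)"
      have "integral {- Y \<nu>..0} ?G = Y \<nu> * integral {0..1} (\<lambda>s. 2 * s * ?G (- (Y \<nu> * s\<^sup>2)))"
        using Y by (intro integral_neg_substitution_square continuous_intros)
      also have "(\<lambda>s. 2 * s * ?G (- (Y \<nu> * s\<^sup>2))) =
          (\<lambda>s. sqrt (Y \<nu>) * (2 * s * exp (- (A / 2 * s\<^sup>2)) * (airy_energy (\<delta> \<nu> - Y \<nu> * s\<^sup>2) / sqrt (Y \<nu>))))"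
        using Y by (simp add: fun_eq_iff \<delta>_def mult.assoc[symmetric] bY[OF elim(2)])
      also have "Y \<nu> * integral {0..1} \<dots> = Y \<nu> * sqrt (Y \<nu>) * ?I \<nu>"
        by (simp only: integral_mult_right mult.assoc)
      also have "Y \<nu> * sqrt (Y \<nu>) = \<nu> ^ 3 * (w * sqrt w)"
        using elim by (simp add: Y_def real_sqrt_mult power2_eq_square power3_eq_cube)
      finally have "integral {- Y \<nu>..0} ?G = \<nu> ^ 3 * (w * sqrt w) * ?I \<nu>" .
      with energy_tail_eq(1)[OF elim(1), of "- Y \<nu>"] Y elim(2) show ?case
        by (simp add: add_divide_distrib)
    qed
    ultimately have "((\<lambda>\<nu>. energy_tail (b \<nu>) (- Y \<nu>) / \<nu> ^ 3) \<longlongrightarrow> m + 0) at_top"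
      by (rule Lim_transform_eventually)
    then show ?thesis by simp
  qed

  let ?q = "\<lambda>\<nu>. - Y \<nu> + b \<nu> ^ 4 / 4"
  have qtop: "filterlim (\<lambda>\<nu>. Y \<nu> - \<delta> \<nu>) at_top at_top"
    using filterlim_tendsto_add_at_top[OF tendsto_minus[OF \<delta>0] Ytop] by (simp add: add.commute)
  have energy: "((\<lambda>\<nu>. airy_energy (?q \<nu>) / \<nu>) \<longlongrightarrow> sqrt w / pi) at_top"
  proof -
    have "((\<lambda>\<nu>. airy_energy (- (Y \<nu> - \<delta> \<nu>)) / sqrt (Y \<nu> - \<delta> \<nu>)) \<longlongrightarrow> 1 / pi) at_top"
      by (rule filterlim_compose[OF airy_energy_asymptotics qtop])
    moreover have "((\<lambda>\<nu>. sqrt (w - \<delta> \<nu> * inverse (\<nu>\<^sup>2))) \<longlongrightarrow> sqrt (w - 0 * 0)) at_top"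
      by (intro tendsto_intros \<delta>0) real_asymp
    ultimately have "((\<lambda>\<nu>. airy_energy (- (Y \<nu> - \<delta> \<nu>)) / sqrt (Y \<nu> - \<delta> \<nu>) * sqrt (w - \<delta> \<nu> * inverse (\<nu>\<^sup>2)))
        \<longlongrightarrow> 1 / pi * sqrt (w - 0 * 0)) at_top"
      by (rule tendsto_mult)
    moreover have "\<forall>\<^sub>F \<nu> in at_top. Y \<nu> - \<delta> \<nu> \<ge> 1" using qtop by (simp add: filterlim_at_top)
    with ev_pos have "\<forall>\<^sub>F \<nu> in at_top. airy_energy (- (Y \<nu> - \<delta> \<nu>)) / sqrt (Y \<nu> - \<delta> \<nu>) * sqrt (w - \<delta> \<nu> * inverse (\<nu>\<^sup>2))
        = airy_energy (?q \<nu>) / \<nu>"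
    proof eventually_elim
      case (elim \<nu>)
      have "w - \<delta> \<nu> * inverse (\<nu>\<^sup>2) = (Y \<nu> - \<delta> \<nu>) / \<nu>\<^sup>2" using elim by (simp add: Y_def field_simps)
      then have "sqrt (w - \<delta> \<nu> * inverse (\<nu>\<^sup>2)) = sqrt (Y \<nu> - \<delta> \<nu>) / \<nu>"
        using elim by (simp add: real_sqrt_divide)
      then show ?case using elim by (simp add: \<delta>_def)
    qed
    ultimately have "((\<lambda>\<nu>. airy_energy (?q \<nu>) / \<nu>) \<longlongrightarrow> 1 / pi * sqrt (w - 0 * 0)) at_top"
      by (rule Lim_transform_eventually)
    then show ?thesis by simp
  qed

  \<comment> \<open>Each quantity is divided by the power of \<open>\<nu>\<close> that it can
    afford. The integral in \<open>s\<close> gets only one power, because \<open>T0\<close>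
    multiplies it by a further \<open>\<nu>\<^sup>2 * w\<close>.\<close>
  define x where "x \<nu> = T3 (b \<nu>) (- Y \<nu>) / \<nu> ^ 3" for \<nu>
  define s where "s \<nu> = integral {- Y \<nu>..} (\<lambda>p. (deformed_Ai (b \<nu>) p)\<^sup>2) / \<nu>" for \<nu>
  define d where "d \<nu> = (deformed_Ai (b \<nu>) (- Y \<nu>))\<^sup>2 / \<nu> ^ 3" for \<nu>
  define e where "e \<nu> = deformed_Ai (b \<nu>) (- Y \<nu>) * deriv (deformed_Ai (b \<nu>)) (- Y \<nu>) / \<nu> ^ 3" for \<nu>
  define K where "K \<nu> = exp (b \<nu> ^ 6 / 6)" for \<nu>
  have K: "(K \<longlongrightarrow> 1) at_top"
    using tendsto_exp[OF tendsto_divide[OF bpow[of 5] tendsto_const[of 6]]] by (simp add: K_def[abs_def] numeral_eq_Suc)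
  have x: "(x \<longlongrightarrow> m) at_top"
    using tendsto_mult[OF K tail] by (simp add: x_def[abs_def] K_def T3_eq)
  have s: "(s \<longlongrightarrow> w * sqrt w * J / (w * pi)) at_top"
  proof -
    have "((\<lambda>\<nu>. K \<nu> * (exp (- (A / 2)) * (airy_energy (?q \<nu>) / \<nu>) + a\<^sup>2 / 2 * (energy_tail (b \<nu>) (- Y \<nu>) / \<nu> ^ 3)))
        \<longlongrightarrow> 1 * (exp (- (A / 2)) * (sqrt w / pi) + a\<^sup>2 / 2 * m)) at_top"
      by (intro tendsto_intros K energy tail)
    moreover have "\<forall>\<^sub>F \<nu> in at_top. K \<nu> * (exp (- (A / 2)) * (airy_energy (?q \<nu>) / \<nu>) + a\<^sup>2 / 2 * (energy_tail (b \<nu>) (- Y \<nu>) / \<nu> ^ 3)) = s \<nu>"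
      using ev_b ev_pos
    proof eventually_elim
      case (elim \<nu>)
      have Y: "- Y \<nu> \<le> 0" using elim assms by (simp add: Y_def)
      have "s \<nu> = K \<nu> * (exp (- (A / 2)) * airy_energy (?q \<nu>) + a\<^sup>2 / (2 * \<nu>\<^sup>2) * energy_tail (b \<nu>) (- Y \<nu>)) / \<nu>"
        unfolding s_def integral_deformed_Ai_sq[OF elim(1) Y] K_def
        using bY[OF elim(2)] by (simp add: b2)
      then show ?case using elim(2) by (simp add: field_simps power2_eq_square power3_eq_cube)
    qed
    ultimately have "(s \<longlongrightarrow> 1 * (exp (- (A / 2)) * (sqrt w / pi) + a\<^sup>2 / 2 * m)) at_top"
      by (rule Lim_transform_eventually)
    \<comment> \<open>Since \<open>A = a\<^sup>2 * w\<close>, the summand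
      \<open>a\<^sup>2 / 2 * m\<close> is \<open>sqrt w / pi * (J - exp (- (A / 2)))\<close>, so the
      boundary exponential cancels and \<open>sqrt w * J / pi\<close> remains.\<close>
    moreover have "1 * (exp (- (A / 2)) * (sqrt w / pi) + a\<^sup>2 / 2 * m) = w * sqrt w * J / (w * pi)"
      using assms by (simp add: m_def field_simps)
    ultimately show ?thesis by simp
  qed

  \<comment> \<open>One majorant serves \<open>d\<close> and \<open>e\<close>: the energy has order
    \<open>\<nu>\<close>, so against \<open>\<nu> ^ 3\<close> a factor
    \<open>inverse (\<nu>\<^sup>2)\<close> is left over. The summand
    \<open>(b \<nu>)\<^sup>2 / 2\<close> comes from differentiating the exponential in
    \<open>deformed_Ai\<close>.\<close>
  have bound: "((\<lambda>\<nu>. K \<nu> * exp (- (A / 2)) * ((b \<nu>)\<^sup>2 / 2 + 1) * (airy_energy (?q \<nu>) / \<nu> * inverse (\<nu>\<^sup>2))) \<longlongrightarrow>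
      1 * exp (- (A / 2)) * (0 / 2 + 1) * (sqrt w / pi * 0)) at_top"
    using bpow[of 1] by (intro tendsto_intros K energy) (simp_all add: numeral_2_eq_2, real_asymp)
  have ev_q: "\<forall>\<^sub>F \<nu> in at_top. ?q \<nu> \<le> - 1"
  proof -
    have "\<forall>\<^sub>F \<nu> in at_top. Y \<nu> - \<delta> \<nu> \<ge> 1" using qtop by (simp add: filterlim_at_top)
    then show ?thesis by eventually_elim (simp add: \<delta>_def)
  qed
  have Ebound: "K \<nu> * exp (- (A / 2)) * z / \<nu> ^ 3 \<le>
      K \<nu> * exp (- (A / 2)) * ((b \<nu>)\<^sup>2 / 2 + 1) * (airy_energy (?q \<nu>) / \<nu> * inverse (\<nu>\<^sup>2))"
    if "\<nu> > 0" "z \<le> ((b \<nu>)\<^sup>2 / 2 + 1) * airy_energy (?q \<nu>)" for \<nu> z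
  proof -
    have "K \<nu> * exp (- (A / 2)) * z / \<nu> ^ 3 \<le> K \<nu> * exp (- (A / 2)) * (((b \<nu>)\<^sup>2 / 2 + 1) * airy_energy (?q \<nu>)) / \<nu> ^ 3"
      using that by (intro divide_right_mono mult_left_mono) (auto simp: K_def)
    then show ?thesis using that by (simp add: field_simps power2_eq_square power3_eq_cube)
  qed
  have d: "(d \<longlongrightarrow> 0) at_top"
  proof (rule Lim_null_comparison)
    show "\<forall>\<^sub>F \<nu> in at_top. norm (d \<nu>) \<le>
        K \<nu> * exp (- (A / 2)) * ((b \<nu>)\<^sup>2 / 2 + 1) * (airy_energy (?q \<nu>) / \<nu> * inverse (\<nu>\<^sup>2))"
      using ev_pos ev_q
    proof eventually_elim
      case (elim \<nu>)
      have "norm (d \<nu>) = K \<nu> * exp (- (A / 2)) * (Airy_Ai (?q \<nu>))\<^sup>2 / \<nu> ^ 3"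
        using elim bY[OF elim(1)] by (simp add: d_def deformed_Ai_sq K_def)
      also have "(Airy_Ai (?q \<nu>))\<^sup>2 \<le> ((b \<nu>)\<^sup>2 / 2 + 1) * airy_energy (?q \<nu>)"
        using Airy_Ai_le_energy(1)[OF elim(2)] order_trans[OF zero_le_power2 Airy_Ai_le_energy(1)[OF elim(2)]]
        by (simp add: distrib_right add_increasing)
      from Ebound[OF elim(1) this] show ?case using calculation by simp
    qed
    show "((\<lambda>\<nu>. K \<nu> * exp (- (A / 2)) * ((b \<nu>)\<^sup>2 / 2 + 1) * (airy_energy (?q \<nu>) / \<nu> * inverse (\<nu>\<^sup>2))) \<longlongrightarrow> 0) at_top"
      using bound by simp
  qed
  have e: "(e \<longlongrightarrow> 0) at_top"
  proof (rule Lim_null_comparison)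
    show "\<forall>\<^sub>F \<nu> in at_top. norm (e \<nu>) \<le>
        K \<nu> * exp (- (A / 2)) * ((b \<nu>)\<^sup>2 / 2 + 1) * (airy_energy (?q \<nu>) / \<nu> * inverse (\<nu>\<^sup>2))"
      using ev_pos ev_q
    proof eventually_elim
      case (elim \<nu>)
      let ?z = "(b \<nu>)\<^sup>2 / 2 * (Airy_Ai (?q \<nu>))\<^sup>2 + Airy_Ai (?q \<nu>) * deriv Airy_Ai (?q \<nu>)"
      have "norm (e \<nu>) = K \<nu> * exp (- (A / 2)) * \<bar>?z\<bar> / \<nu> ^ 3"
        using elim bY[OF elim(1)] by (simp add: e_def deformed_Ai_mult_deriv K_def abs_mult abs_divide)
      moreover have "\<bar>?z\<bar> \<le> ((b \<nu>)\<^sup>2 / 2 + 1) * airy_energy (?q \<nu>)"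
      proof -
        have "\<bar>?z\<bar> \<le> (b \<nu>)\<^sup>2 / 2 * (Airy_Ai (?q \<nu>))\<^sup>2 + \<bar>Airy_Ai (?q \<nu>) * deriv Airy_Ai (?q \<nu>)\<bar>"
          by (rule order_trans[OF abs_triangle_ineq]) simp
        also have "\<dots> \<le> (b \<nu>)\<^sup>2 / 2 * airy_energy (?q \<nu>) + airy_energy (?q \<nu>)"
          using Airy_Ai_le_energy[OF elim(2)] by (intro add_mono mult_left_mono) auto
        finally show ?thesis by (simp add: algebra_simps)
      qed
      ultimately show ?case using Ebound[OF elim(1)] by simp
    qed
    show "((\<lambda>\<nu>. K \<nu> * exp (- (A / 2)) * ((b \<nu>)\<^sup>2 / 2 + 1) * (airy_energy (?q \<nu>) / \<nu> * inverse (\<nu>\<^sup>2))) \<longlongrightarrow> 0) at_top"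
      using bound by simp
  qed

  let ?S = "w * sqrt w * J / (w * pi)"
  \<comment> \<open>This is the bracket of the density divided by \<open>\<nu> ^ 3\<close>. The
    coefficient \<open>A / 2\<close> is \<open>(b \<nu>)\<^sup>2 * Y \<nu>\<close>; in the limit
    only \<open>- x\<close>, \<open>w * s\<close> and \<open>A / 2 * x / t\<close> survive.\<close>
  let ?B = "\<lambda>\<nu>. - x \<nu> + 1 / 2 * (b \<nu>)\<^sup>2 * d \<nu> - 1 / 2 * e \<nu> + w * s \<nu>
    + (A / 2 * x \<nu> + 1 / 2 * (b \<nu>)\<^sup>2 * d \<nu> + b \<nu> ^ 4 * (s \<nu> * inverse (\<nu>\<^sup>2))) / t
    + (b \<nu> ^ 6 * x \<nu> + b \<nu> ^ 4 * (s \<nu> * inverse (\<nu>\<^sup>2))) / t\<^sup>2 + b \<nu> ^ 6 * x \<nu> / t ^ 3"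
  let ?E = "\<lambda>\<nu>. exp (- (A / (2 * t)) - b \<nu> ^ 6 / (2 * t\<^sup>2) - b \<nu> ^ 6 / (3 * t ^ 3))"
  have b246: "((\<lambda>\<nu>. (b \<nu>)\<^sup>2) \<longlongrightarrow> 0) at_top" "((\<lambda>\<nu>. b \<nu> ^ 4) \<longlongrightarrow> 0) at_top" "((\<lambda>\<nu>. b \<nu> ^ 6) \<longlongrightarrow> 0) at_top"
    using bpow[of 1] bpow[of 3] bpow[of 5] by (simp_all add: numeral_eq_Suc)
  have inv: "((\<lambda>\<nu>::real. inverse (\<nu>\<^sup>2)) \<longlongrightarrow> 0) at_top" by real_asymp
  \<comment> \<open>The limit keeps its zeros so that it matches \<open>?B\<close> and
    \<open>?E\<close> term by term; it is simplified at the end.\<close>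
  have "((\<lambda>\<nu>. a\<^sup>2 / (2 * t\<^sup>2) * ?B \<nu> * ?E \<nu>) \<longlongrightarrow>
      a\<^sup>2 / (2 * t\<^sup>2) * (- m + 1 / 2 * 0 * 0 - 1 / 2 * 0 + w * ?S
        + (A / 2 * m + 1 / 2 * 0 * 0 + 0 * (?S * 0)) / t + (0 * m + 0 * (?S * 0)) / t\<^sup>2 + 0 * m / t ^ 3) *
      exp (- (A / (2 * t)) - 0 / (2 * t\<^sup>2) - 0 / (3 * t ^ 3))) at_top"
    using assms(3) by (intro tendsto_mult tendsto_add tendsto_diff tendsto_minus tendsto_divide tendsto_exp
        tendsto_const b246 inv x s d e) simp_all
  moreover have "\<forall>\<^sub>F \<nu> in at_top. a\<^sup>2 / (2 * t\<^sup>2) * ?B \<nu> * ?E \<nu> = inverse \<nu> * P_we (b \<nu>) (- Y \<nu>) t"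
    using ev_pos
  proof eventually_elim
    case (elim \<nu>)
    let ?T3 = "T3 (b \<nu>) (- Y \<nu>)" and ?I = "integral {- Y \<nu>..} (\<lambda>p. (deformed_Ai (b \<nu>) p)\<^sup>2)"
    have v: "?T3 = \<nu> ^ 3 * x \<nu>" "?I = \<nu> * s \<nu>" "(deformed_Ai (b \<nu>) (- Y \<nu>))\<^sup>2 = \<nu> ^ 3 * d \<nu>"
      "deformed_Ai (b \<nu>) (- Y \<nu>) * deriv (deformed_Ai (b \<nu>)) (- Y \<nu>) = \<nu> ^ 3 * e \<nu>"
      using elim by (simp_all add: x_def s_def d_def e_def)
    have "T0 (b \<nu>) (- Y \<nu>) = \<nu> ^ 3 * (- x \<nu> + 1 / 2 * (b \<nu>)\<^sup>2 * d \<nu> - 1 / 2 * e \<nu> + w * s \<nu>)"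
      unfolding T0_def mult.assoc v by (simp add: Y_def algebra_simps power2_eq_square power3_eq_cube)
    moreover have "(b \<nu>)\<^sup>2 * T1 (b \<nu>) (- Y \<nu>) =
        \<nu> ^ 3 * (A / 2 * x \<nu> + 1 / 2 * (b \<nu>)\<^sup>2 * d \<nu> + b \<nu> ^ 4 * (s \<nu> * inverse (\<nu>\<^sup>2)))"
    proof -
      have "(b \<nu>)\<^sup>2 * T1 (b \<nu>) (- Y \<nu>) = ((b \<nu>)\<^sup>2 * Y \<nu>) * (\<nu> ^ 3 * x \<nu>) + (b \<nu>)\<^sup>2 * (1 / 2 * (\<nu> ^ 3 * d \<nu>))
          + (b \<nu>)\<^sup>2 * (b \<nu>)\<^sup>2 * (\<nu> * s \<nu>)"
        unfolding T1_def v by (simp add: algebra_simps)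
      also have "(b \<nu>)\<^sup>2 * (b \<nu>)\<^sup>2 = b \<nu> ^ 4" by (simp flip: power_add)
      finally show ?thesis unfolding bY[OF elim]
        using elim by (simp add: field_simps power2_eq_square power3_eq_cube)
    qed
    moreover have "b \<nu> ^ 4 * T2 (b \<nu>) (- Y \<nu>) = \<nu> ^ 3 * (b \<nu> ^ 6 * x \<nu> + b \<nu> ^ 4 * (s \<nu> * inverse (\<nu>\<^sup>2)))"
    proof -
      have "b \<nu> ^ 4 * T2 (b \<nu>) (- Y \<nu>) = b \<nu> ^ 4 * (b \<nu>)\<^sup>2 * (\<nu> ^ 3 * x \<nu>) + b \<nu> ^ 4 * (\<nu> * s \<nu>)"
        unfolding T2_def v by (simp add: algebra_simps)
      also have "b \<nu> ^ 4 * (b \<nu>)\<^sup>2 = b \<nu> ^ 6" by (simp flip: power_add)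
      finally show ?thesis
        using elim by (simp add: field_simps power2_eq_square power3_eq_cube)
    qed
    moreover have "(b \<nu>)\<^sup>2 * - Y \<nu> / t = - (A / (2 * t))"
      unfolding mult_minus_right bY[OF elim] by simp
    ultimately have "P_we (b \<nu>) (- Y \<nu>) t = (b \<nu>)\<^sup>2 / t\<^sup>2 * (\<nu> ^ 3 * ?B \<nu>) * ?E \<nu>"
      unfolding P_we_def v by (simp only:) (simp add: algebra_simps add_divide_distrib)
    \<comment> \<open>The prefactor has order \<open>1 / \<nu>\<^sup>2\<close>, so one power of
      \<open>\<nu>\<close> is left, which the normalisation \<open>inverse \<nu>\<close>
      removes.\<close>
    also have "(b \<nu>)\<^sup>2 / t\<^sup>2 * (\<nu> ^ 3 * ?B \<nu>) = \<nu> * (a\<^sup>2 / (2 * t\<^sup>2) * ?B \<nu>)"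
    proof -
      have "a\<^sup>2 / (2 * \<nu>\<^sup>2) / t\<^sup>2 * (\<nu> ^ 3 * z) = \<nu> * (a\<^sup>2 / (2 * t\<^sup>2) * z)" for z
        using elim by (simp add: field_simps power2_eq_square power3_eq_cube)
      then show ?thesis unfolding b2 .
    qed
    finally show ?case using elim by simp
  qed
  ultimately have "((\<lambda>\<nu>. inverse \<nu> * P_we (b \<nu>) (- Y \<nu>) t) \<longlongrightarrow>
      a\<^sup>2 / (2 * t\<^sup>2) * (- m + 1 / 2 * 0 * 0 - 1 / 2 * 0 + w * ?S
        + (A / 2 * m + 1 / 2 * 0 * 0 + 0 * (?S * 0)) / t + (0 * m + 0 * (?S * 0)) / t\<^sup>2 + 0 * m / t ^ 3) *
      exp (- (A / (2 * t)) - 0 / (2 * t\<^sup>2) - 0 / (3 * t ^ 3))) at_top"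
    by (rule Lim_transform_eventually)
  moreover have "a\<^sup>2 / (2 * t\<^sup>2) * (- m + 1 / 2 * 0 * 0 - 1 / 2 * 0 + w * ?S
        + (A / 2 * m + 1 / 2 * 0 * 0 + 0 * (?S * 0)) / t + (0 * m + 0 * (?S * 0)) / t\<^sup>2 + 0 * m / t ^ 3) *
      exp (- (A / (2 * t)) - 0 / (2 * t\<^sup>2) - 0 / (3 * t ^ 3)) =
      A * sqrt w / (2 * pi * t\<^sup>2) * exp (- (A / (2 * t))) *
       ((2 / A - 1 / t) * exp (- (A / 2)) + (1 + 1 / t - 2 / A) * J)"
  proof -
    \<comment> \<open>After extracting \<open>w * sqrt w / pi\<close> the bracket is
      \<open>(1 / t - 2 / A) * (J - exp (- (A / 2))) + J\<close>; collecting the terms with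
      \<open>J\<close> gives the stated form.\<close>
    have "a\<^sup>2 / (2 * t\<^sup>2) * (- m + w * ?S + A / 2 * m / t) =
        A * sqrt w / (2 * pi * t\<^sup>2) * ((2 / A - 1 / t) * exp (- (A / 2)) + (1 + 1 / t - 2 / A) * J)"
      unfolding m_def assms(4) using assms(1-3) by (simp add: field_simps)
    then show ?thesis by (simp add: mult.commute mult.left_commute)
  qed
  ultimately show ?thesis
    unfolding b_def Y_def J_def by simp
qed

end
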